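(* Let $M$ be an $F$-structure manifold of degree $K$. The distribution $D_l$ is integrable if and only if $$N_F(X,Y)=l\,N_F(X,Y)\quad\text{for all vector fields }X,Y\text{ on }M,$$ or, equivalently, if and only if $[FX,FY]=l[FX,FY]$ for all vector fields $X,Y$ on $M$.
   Context: An $F$-structure manifold of degree $K$ is a smooth $n$-dimensional manifold $M$ with a nonzero smooth $(1,1)$-tensor field $F$ of constant rank $r$ satisfying $\alpha F^{K+1}+\beta F^{K}+F=0$, where $K\ge 3$ is an integer and $\alpha,\beta$ are real or complex numbers (polynomials in $F$ with complex coefficients are regarded as endomorphisms of the complexified tangent bundle). Put $l=-(\alpha F^{K}+\beta F^{K-1})$ and $m=I+\alpha F^{K}+\beta F^{K-1}$; $D_l=\mathrm{Im}\,l$ and $D_m=\mathrm{Im}\,m$ are complementary distributions of dimensions $r$ and $n-r$. For a $(1,1)$-tensor field $T$, the Nijenhuis tensor is $N_T(X,Y)=[TX,TY]-T[TX,Y]-T[X,TY]+T^2[X,Y]$. A distribution $D$ is integrable if through each point of $M$ there is an integral manifold of $D$ (equivalently, by Frobenius, $D$ is involutive). *)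

theory Defs
  imports "HOL-Analysis.Analysis"
begin

section \<open>Smooth maps between open subsets of Euclidean spaces\<close>

text \<open>Both notions are meant for open \<open>S\<close> only: the derivatives are taken with respect to the
  unrestricted neighbourhoods \<open>at x\<close>, so values of \<open>f\<close> outside an open \<open>S\<close> are irrelevant.\<close>

primrec Ck_on :: "nat \<Rightarrow> ('a::real_normed_vector \<Rightarrow> 'b::real_normed_vector) \<Rightarrow> 'a set \<Rightarrow> bool" where
  "Ck_on 0 f S \<longleftrightarrow> continuous_on S f"
| "Ck_on (Suc k) f S \<longleftrightarrow>
     (\<forall>x\<in>S. f differentiable (at x)) \<and> (\<forall>v. Ck_on k (\<lambda>x. frechet_derivative f (at x) v) S)"

definition smooth_on :: "('a::real_normed_vector \<Rightarrow> 'b::real_normed_vector) \<Rightarrow> 'a set \<Rightarrow> bool" where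
  "smooth_on f S \<longleftrightarrow> (\<forall>k. Ck_on k f S)"


section \<open>Smooth manifolds\<close>

text \<open>The points of the manifold are all elements of a (Hausdorff, second countable) type \<open>'a\<close>.
  A chart \<open>(U, \<phi>)\<close> consists of its open domain and a coordinate map; \<open>\<phi>\<close> is a total function, but
  only its values on \<open>U\<close> matter. All components of tensors below are indexed by charts.\<close>

type_synonym ('a, 'n) chart = "'a set \<times> ('a \<Rightarrow> real ^ 'n)"

definition is_chart :: "('a::topological_space, 'n::finite) chart \<Rightarrow> bool" where
  "is_chart c \<longleftrightarrow> open (fst c) \<and> open (snd c ` fst c)
     \<and> (\<exists>\<psi>. homeomorphism (fst c) (snd c ` fst c) (snd c) \<psi>)"

definition chart_inv :: "('a, 'n::finite) chart \<Rightarrow> real ^ 'n \<Rightarrow> 'a" where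
  "chart_inv c = inv_into (fst c) (snd c)"

definition transition :: "('a, 'n::finite) chart \<Rightarrow> ('a, 'n) chart \<Rightarrow> real ^ 'n \<Rightarrow> real ^ 'n" where
  "transition c d = snd d \<circ> chart_inv c"

definition transition_jacobian ::
    "('a, 'n::finite) chart \<Rightarrow> ('a, 'n) chart \<Rightarrow> 'a \<Rightarrow> real ^ 'n ^ 'n" where
  "transition_jacobian c d p = jacobian (transition c d) (at (snd c p))"

definition smoothly_compatible ::
    "('a, 'n::finite) chart \<Rightarrow> ('a, 'n) chart \<Rightarrow> bool" where
  "smoothly_compatible c d \<longleftrightarrow>
     smooth_on (transition c d) (snd c ` (fst c \<inter> fst d)) \<and>
     smooth_on (transition d c) (snd d ` (fst c \<inter> fst d))"

text \<open>A smooth structure is a maximal smooth atlas. Being a manifold of dimension \<open>n\<close> means that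
  \<open>CARD('n) = n\<close>.\<close>

definition smooth_structure ::
    "('a::{t2_space, second_countable_topology}, 'n::finite) chart set \<Rightarrow> bool" where
  "smooth_structure A \<longleftrightarrow>
     (\<forall>c\<in>A. is_chart c) \<and> (\<Union>c\<in>A. fst c) = UNIV \<and>
     (\<forall>c\<in>A. \<forall>d\<in>A. smoothly_compatible c d) \<and>
     (\<forall>c. is_chart c \<and> (\<forall>d\<in>A. smoothly_compatible c d) \<longrightarrow> c \<in> A)"


section \<open>Vector fields and (1,1)-tensor fields\<close>

text \<open>Vector fields and (1,1)-tensor fields are given by their components in every chart, subject
  to the usual transformation laws. Components are only meaningful for charts of the smooth
  structure and at points of their domain, so equality of tensor fields means equality of
  components there. A complex-valued field (a section of the complexified bundle) has complex
  components.\<close>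

type_synonym ('a, 'n, 'k) vfield = "('a, 'n) chart \<Rightarrow> 'a \<Rightarrow> 'k ^ 'n"
type_synonym ('a, 'n, 'k) tfield = "('a, 'n) chart \<Rightarrow> 'a \<Rightarrow> 'k ^ 'n ^ 'n"

definition smooth_vector_field ::
    "('a, 'n::finite) chart set \<Rightarrow> ('a, 'n, real) vfield \<Rightarrow> bool" where
  "smooth_vector_field A X \<longleftrightarrow>
     (\<forall>c\<in>A. smooth_on (\<lambda>x. X c (chart_inv c x)) (snd c ` fst c)) \<and>
     (\<forall>c\<in>A. \<forall>d\<in>A. \<forall>p \<in> fst c \<inter> fst d. X d p = transition_jacobian c d p *v X c p)"

definition smooth_tensor_field ::
    "('a, 'n::finite) chart set \<Rightarrow> ('a, 'n, real) tfield \<Rightarrow> bool" where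
  "smooth_tensor_field A T \<longleftrightarrow>
     (\<forall>c\<in>A. smooth_on (\<lambda>x. T c (chart_inv c x)) (snd c ` fst c)) \<and>
     (\<forall>c\<in>A. \<forall>d\<in>A. \<forall>p \<in> fst c \<inter> fst d.
        T d p ** transition_jacobian c d p = transition_jacobian c d p ** T c p)"

definition vfield_eq ::
    "('a, 'n::finite) chart set \<Rightarrow> ('a, 'n, 'k) vfield \<Rightarrow> ('a, 'n, 'k) vfield \<Rightarrow> bool" where
  "vfield_eq A X Y \<longleftrightarrow> (\<forall>c\<in>A. \<forall>p\<in>fst c. X c p = Y c p)"

definition tensor_apply ::
    "('a, 'n::finite, 'k::semiring_1) tfield \<Rightarrow> ('a, 'n, 'k) vfield \<Rightarrow> ('a, 'n, 'k) vfield" where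
  "tensor_apply T X = (\<lambda>c p. T c p *v X c p)"

text \<open>In coordinates, \<open>[X,Y]\<^sup>i = \<Sum>\<^sub>j X\<^sup>j \<partial>\<^sub>j Y\<^sup>i - Y\<^sup>j \<partial>\<^sub>j X\<^sup>i\<close>.\<close>

definition lie_bracket ::
    "('a, 'n::finite, real) vfield \<Rightarrow> ('a, 'n, real) vfield \<Rightarrow> ('a, 'n, real) vfield" where
  "lie_bracket X Y = (\<lambda>c p.
     frechet_derivative (\<lambda>x. Y c (chart_inv c x)) (at (snd c p)) (X c p) -
     frechet_derivative (\<lambda>x. X c (chart_inv c x)) (at (snd c p)) (Y c p))"

definition nijenhuis :: "('a, 'n::finite, real) tfield \<Rightarrow>
    ('a, 'n, real) vfield \<Rightarrow> ('a, 'n, real) vfield \<Rightarrow> ('a, 'n, real) vfield" where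
  "nijenhuis T X Y = (\<lambda>c p.
     lie_bracket (tensor_apply T X) (tensor_apply T Y) c p
     - tensor_apply T (lie_bracket (tensor_apply T X) Y) c p
     - tensor_apply T (lie_bracket X (tensor_apply T Y)) c p
     + tensor_apply T (tensor_apply T (lie_bracket X Y)) c p)"


section \<open>Complexification\<close>

definition complexify_vfield :: "('a, 'n::finite, real) vfield \<Rightarrow> ('a, 'n, complex) vfield" where
  "complexify_vfield X = (\<lambda>c p. \<chi> i. of_real (X c p $ i))"

definition complexify_tfield :: "('a, 'n::finite, real) tfield \<Rightarrow> ('a, 'n, complex) tfield" where
  "complexify_tfield T = (\<lambda>c p. map_matrix of_real (T c p))"

text \<open>\<open>V + i V\<close>, the complexification of a real subspace \<open>V\<close>, as a subspace of \<open>\<complex>\<^sup>n\<close>.\<close>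

definition complexify_subspace :: "(real ^ 'n::finite) set \<Rightarrow> (complex ^ 'n) set" where
  "complexify_subspace V = {w. (\<chi> i. Re (w $ i)) \<in> V \<and> (\<chi> i. Im (w $ i)) \<in> V}"


section \<open>Integral manifolds\<close>

text \<open>Slices are taken with arbitrary linear subspaces \<open>V\<close> rather than coordinate subspaces; the two
  differ by a linear change of the chart.\<close>

definition slice_chart :: "('a, 'n::finite) chart set \<Rightarrow> 'a set \<Rightarrow> 'a \<Rightarrow>
    ('a, 'n) chart \<Rightarrow> (real ^ 'n) set \<Rightarrow> bool" where
  "slice_chart A S q c V \<longleftrightarrow>
     c \<in> A \<and> q \<in> fst c \<and> subspace V \<and> snd c ` (S \<inter> fst c) = snd c ` fst c \<inter> V"

definition embedded_submanifold ::
    "('a, 'n::finite) chart set \<Rightarrow> nat \<Rightarrow> 'a set \<Rightarrow> bool" where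
  "embedded_submanifold A d S \<longleftrightarrow> (\<forall>q\<in>S. \<exists>c V. slice_chart A S q c V \<and> dim V = d)"

text \<open>The tangent space of \<open>S\<close> at \<open>q\<close>, expressed in the coordinates of the chart \<open>c\<close>. It is
  \<open>V\<close> in any slice chart \<open>(b, V)\<close> around \<open>q\<close>, hence the union below is over equal sets.\<close>

definition submanifold_tangent_space ::
    "('a, 'n::finite) chart set \<Rightarrow> 'a set \<Rightarrow> ('a, 'n) chart \<Rightarrow> 'a \<Rightarrow> (real ^ 'n) set" where
  "submanifold_tangent_space A S c q =
     {transition_jacobian b c q *v v | b V v. slice_chart A S q b V \<and> v \<in> V}"

text \<open>A complex distribution assigns to each point a subspace of the complexified tangent space,
  again expressed in every chart. Integral manifolds are real submanifolds of \<open>M\<close>; the condition is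
  \<open>T\<^sub>q S \<otimes> \<complex> = D\<^sub>q\<close>, which for the complexification \<open>D = E \<otimes> \<complex>\<close> of a real distribution \<open>E\<close> says
  \<open>T\<^sub>q S = E\<^sub>q\<close>. Immersed submanifolds are locally embedded, so for the existence of an integral
  manifold through each point it makes no difference that only embedded ones are considered.\<close>

type_synonym ('a, 'n) distribution = "('a, 'n) chart \<Rightarrow> 'a \<Rightarrow> (complex ^ 'n) set"

definition integral_manifold ::
    "('a, 'n::finite) chart set \<Rightarrow> ('a, 'n) distribution \<Rightarrow> 'a set \<Rightarrow> bool" where
  "integral_manifold A D S \<longleftrightarrow>
     (\<exists>d. embedded_submanifold A d S) \<and>
     (\<forall>q\<in>S. \<forall>c\<in>A. q \<in> fst c \<longrightarrow>
        complexify_subspace (submanifold_tangent_space A S c q) = D c q)"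

definition integrable_distribution ::
    "('a, 'n::finite) chart set \<Rightarrow> ('a, 'n) distribution \<Rightarrow> bool" where
  "integrable_distribution A D \<longleftrightarrow> (\<forall>p. \<exists>S. p \<in> S \<and> integral_manifold A D S)"


section \<open>F-structure manifolds of degree K\<close>

text \<open>\<open>mat a ** B\<close> is the scalar multiple \<open>a B\<close>, and \<open>matpow B k\<close> the \<open>k\<close>-th power with respect to
  matrix multiplication (the overloaded \<open>^\<close> on vectors would be componentwise).\<close>

definition matpow :: "'k::semiring_1 ^ 'n ^ 'n::finite \<Rightarrow> nat \<Rightarrow> 'k ^ 'n ^ 'n" where
  "matpow B k = (((**) B) ^^ k) (mat 1)"

definition F_structure_manifold :: "('a::{t2_space, second_countable_topology}, 'n::finite) chart set
    \<Rightarrow> nat \<Rightarrow> complex \<Rightarrow> complex \<Rightarrow> nat \<Rightarrow> ('a, 'n, real) tfield \<Rightarrow> bool" where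
  "F_structure_manifold A K \<alpha> \<beta> r F \<longleftrightarrow>
     smooth_structure A \<and> K \<ge> 3 \<and>
     smooth_tensor_field A F \<and>
     (\<exists>c\<in>A. \<exists>p\<in>fst c. F c p \<noteq> 0) \<and>
     (\<forall>c\<in>A. \<forall>p\<in>fst c. rank (F c p) = r) \<and>
     (\<forall>c\<in>A. \<forall>p\<in>fst c. let B = complexify_tfield F c p in
        mat \<alpha> ** matpow B (K + 1) + mat \<beta> ** matpow B K + B = 0)"

definition l_tensor :: "nat \<Rightarrow> complex \<Rightarrow> complex \<Rightarrow> ('a, 'n::finite, real) tfield
    \<Rightarrow> ('a, 'n, complex) tfield" where
  "l_tensor K \<alpha> \<beta> F = (\<lambda>c p. let B = complexify_tfield F c p in
     - (mat \<alpha> ** matpow B K + mat \<beta> ** matpow B (K - 1)))"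

definition D_l :: "nat \<Rightarrow> complex \<Rightarrow> complex \<Rightarrow> ('a, 'n::finite, real) tfield
    \<Rightarrow> ('a, 'n) distribution" where
  "D_l K \<alpha> \<beta> F = (\<lambda>c p. range ((*v) (l_tensor K \<alpha> \<beta> F c p)))"

end

theory Submission
  imports Defs
begin

text \<open>By the polynomial identity, \<open>l\<close> acts as the identity on \<open>Im F\<close> and has image \<open>Im F\<close>, so
  \<open>D\<^sub>l\<close> is the complexification of the real distribution \<open>Im F\<close> and \<open>l w = w\<close> means
  \<open>w \<in> Im F\<close>. Since \<open>N\<^sub>F(X,Y) - [FX,FY] \<in> Im F\<close>, both conditions say that \<open>Im F\<close> is involutive,
  and the claim is Frobenius' theorem. For existence of leaves, choose near a point the frame
  \<open>G x v \<in> Im F\<close> normalised by \<open>P (G x v) = P v\<close>, where \<open>P\<close> projects onto the value of \<open>Im F\<close> at the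
  point; involutivity makes the frame commute, and a leaf is a solution of \<open>Dh(y) = G (h y)\<close>,
  obtained from the ordinary differential equations along rays. Conversely, along an integral
  manifold the fields \<open>FX\<close> and \<open>FY\<close> are tangent to a slice, hence so is their bracket.\<close>

section \<open>Smooth maps\<close>

text \<open>Involutivity is given only for fields \<open>F X\<close> with \<open>X\<close> defined
  on the whole manifold, while Frobenius' theorem argues with local coefficient fields; bump
  functions bridge the two. Constant rank is what makes the frame \<open>G\<close> exist: near the
  point, \<open>Im F\<close> is a graph over its value \<open>V\<close> there, and \<open>P\<close>
  identifies every nearby image with \<open>V\<close>. The normalisation forces brackets of the
  frame to vanish instead of merely lying in \<open>Im F\<close>, and vanishing brackets are exactly
  the compatibility condition of \<open>Dh(y) = G (h y)\<close>, so the leaf is the image of a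
  single map. Along each ray this is an autonomous equation with parameter \<open>y\<close>;
  differentiability in \<open>y\<close> is obtained from a quadratic error estimate, and smoothness
  by bootstrapping the equation itself. Straightening by a shear with explicit inverse gives open
  images directly, and maximality of the atlas turns the result into an admissible chart. A second
  obstacle is that \<open>l\<close> has complex coefficients whereas integral manifolds have real
  tangent spaces: the two can be compared because a real subspace is recovered from its
  complexification as the set of its real vectors.\<close>

lemma Ck_on_cong:
  assumes "Ck_on k f S" "open S" "\<And>x. x \<in> S \<Longrightarrow> f x = g x"
  shows "Ck_on k g S"
  using assms(1,3)
proof (induction k arbitrary: f g)
  case 0
  then show ?case by (simp cong: continuous_on_cong)
next
  case (Suc k)
  have D: "(g has_derivative frechet_derivative f (at x)) (at x)" if x: "x \<in> S" for x
  proof (rule has_derivative_transform_within_open[OF _ assms(2) x])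
    show "(f has_derivative frechet_derivative f (at x)) (at x)"
      using Suc.prems(1) x by (simp add: frechet_derivative_works)
  qed (rule Suc.prems(2))
  have eq: "frechet_derivative f (at x) v = frechet_derivative g (at x) v" if "x \<in> S" for x v
    using frechet_derivative_at[OF D[OF that]] by simp
  have "Ck_on k (\<lambda>x. frechet_derivative g (at x) v) S" for v
    using Suc.IH[OF _ eq] Suc.prems(1) by simp
  then show ?case
    using D by (auto simp: differentiable_def)
qed

lemma Ck_on_subset: "Ck_on k f S \<Longrightarrow> T \<subseteq> S \<Longrightarrow> Ck_on k f T"
  by (induction k arbitrary: f) (auto intro: continuous_on_subset)

lemma Ck_on_Union:
  assumes "\<And>S. S \<in> \<S> \<Longrightarrow> open S" "\<And>S. S \<in> \<S> \<Longrightarrow> Ck_on k f S"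
  shows "Ck_on k f (\<Union>\<S>)"
  using assms(2)
proof (induction k arbitrary: f)
  case 0
  then show ?case using assms(1) by (auto intro: continuous_on_open_Union)
next
  case (Suc k)
  then show ?case by auto
qed

lemma Ck_on_continuous_on: "Ck_on k f S \<Longrightarrow> continuous_on S f"
  by (cases k) (auto intro!: continuous_at_imp_continuous_on differentiable_imp_continuous_within)

lemma Ck_on_SucD: "Ck_on (Suc k) f S \<Longrightarrow> Ck_on k f S"
proof (induction k arbitrary: f)
  case 0
  then show ?case by (rule Ck_on_continuous_on[THEN iffD2[OF Ck_on.simps(1)]])
next
  case (Suc k)
  then show ?case by (metis Ck_on.simps(2))
qed

text \<open>Uniqueness of derivatives at the points of an open set lets an explicit formula
  \<open>f'\<close> replace the derivative selected by \<open>frechet_derivative\<close>; the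
  differentiation rules below enter through it.\<close>

lemma Ck_on_SucI:
  assumes "open S" "\<And>x. x \<in> S \<Longrightarrow> (f has_derivative f' x) (at x)" "\<And>v. Ck_on k (\<lambda>x. f' x v) S"
  shows "Ck_on (Suc k) f S"
proof -
  have "f' x = frechet_derivative f (at x)" if "x \<in> S" for x
    using assms(2)[OF that] by (rule frechet_derivative_at)
  then have "Ck_on k (\<lambda>x. frechet_derivative f (at x) v) S" for v
    using Ck_on_cong[OF assms(3) assms(1)] by simp
  then show ?thesis using assms(2) by (auto simp: differentiable_def)
qed

lemma Ck_on_has_derivative:
  "Ck_on (Suc k) f S \<Longrightarrow> x \<in> S \<Longrightarrow> (f has_derivative frechet_derivative f (at x)) (at x)"
  by (simp add: frechet_derivative_works)

lemma Ck_on_const: "open S \<Longrightarrow> Ck_on k (\<lambda>x. c) S"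
proof (induction k arbitrary: c)
  case (Suc k)
  then show ?case by (intro Ck_on_SucI[where f' = "\<lambda>_ _. 0"]) auto
qed auto

lemma Ck_on_bounded_linear:
  assumes "open S" "bounded_linear f"
  shows "Ck_on k f S"
proof (cases k)
  case 0
  then show ?thesis using assms by (simp add: linear_continuous_on)
next
  case (Suc j)
  then show ?thesis
    using assms by (auto intro!: Ck_on_SucI[where f' = "\<lambda>_. f"] Ck_on_const bounded_linear_imp_has_derivative simp del: Ck_on.simps)
qed

lemma Ck_on_add:
  assumes "open S" "Ck_on k f S" "Ck_on k g S"
  shows "Ck_on k (\<lambda>x. f x + g x) S"
  using assms(2,3)
proof (induction k arbitrary: f g)
  case (Suc k)
  have *: "Ck_on k (\<lambda>x. frechet_derivative f (at x) v + frechet_derivative g (at x) v) S" for v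
    using Suc by simp
  show ?case
    by (rule Ck_on_SucI[where f' = "\<lambda>x v. frechet_derivative f (at x) v + frechet_derivative g (at x) v",
          OF assms(1) _ *])
      (intro has_derivative_add Ck_on_has_derivative[OF Suc.prems(1)] Ck_on_has_derivative[OF Suc.prems(2)])
qed (auto intro: continuous_intros)

text \<open>Leibniz rule: each summand of the derivative keeps one undifferentiated factor, whose
  order \<open>Ck_on_SucD\<close> lowers to fit the induction hypothesis. Scalar multiples, inner
  products and matrix-vector products are all instances.\<close>

lemma Ck_on_bilinear:
  assumes "bounded_bilinear B" "open S" "Ck_on k f S" "Ck_on k g S"
  shows "Ck_on k (\<lambda>x. B (f x) (g x)) S"
  using assms(3,4)
proof (induction k arbitrary: f g)
  case 0
  then show ?case using bounded_bilinear.continuous_on[OF assms(1)] by auto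
next
  case (Suc k)
  have *: "Ck_on k (\<lambda>x. B (f x) (frechet_derivative g (at x) v) + B (frechet_derivative f (at x) v) (g x)) S" for v
    using Suc Ck_on_SucD[OF Suc.prems(1)] Ck_on_SucD[OF Suc.prems(2)]
    by (intro Ck_on_add assms(2) Suc.IH) auto
  show ?case
    by (rule Ck_on_SucI[where f' = "\<lambda>x v. B (f x) (frechet_derivative g (at x) v)
            + B (frechet_derivative f (at x) v) (g x)", OF assms(2) _ *])
      (intro bounded_bilinear.FDERIV[OF assms(1)] Ck_on_has_derivative[OF Suc.prems(1)]
        Ck_on_has_derivative[OF Suc.prems(2)])
qed

lemma Ck_on_sum:
  assumes "open S" "\<And>i. i \<in> I \<Longrightarrow> Ck_on k (f i) S"
  shows "Ck_on k (\<lambda>x. \<Sum>i\<in>I. f i x) S"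
  using assms by (induction I rule: infinite_finite_induct) (auto intro: Ck_on_const Ck_on_add)

lemma frechet_derivative_euclidean:
  fixes f :: "'a::euclidean_space \<Rightarrow> 'b::real_normed_vector"
  assumes "f differentiable (at x)"
  shows "frechet_derivative f (at x) v = (\<Sum>i\<in>Basis. (v \<bullet> i) *\<^sub>R frechet_derivative f (at x) i)"
proof -
  have "linear (frechet_derivative f (at x))" using assms by (rule linear_frechet_derivative)
  then show ?thesis
    by (subst (1) euclidean_representation[of v, symmetric]) (simp add: linear_sum linear_cmul)
qed

lemma Ck_on_compose:
  fixes f :: "'b::euclidean_space \<Rightarrow> 'c::real_normed_vector" and g :: "'a::real_normed_vector \<Rightarrow> 'b"
  assumes "open S" "Ck_on k f T" "Ck_on k g S" "g ` S \<subseteq> T"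
  shows "Ck_on k (\<lambda>x. f (g x)) S"
  using assms(2,3)
proof (induction k arbitrary: f)
  case 0
  then show ?case using assms(4) by (auto intro: continuous_on_compose2)
next
  case (Suc k)
  \<comment> \<open>The chain rule produces a derivative of \<open>f\<close> in a direction that
    varies with \<open>x\<close>, while \<open>Ck_on\<close> controls fixed directions only.
    Expanding the direction in a basis of the middle space leaves a sum of products to which the
    induction hypothesis applies.\<close>
  have *: "Ck_on k (\<lambda>x. \<Sum>i\<in>Basis. (frechet_derivative g (at x) v \<bullet> i) *\<^sub>R
      frechet_derivative f (at (g x)) i) S" for v
    using Suc.prems Ck_on_SucD[OF Suc.prems(2)]
    by (intro Ck_on_sum assms(1) Ck_on_bilinear[OF bounded_bilinear_scaleR]
        Ck_on_bilinear[OF bounded_bilinear_inner] Ck_on_const Suc.IH) auto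
  show ?case
  proof (rule Ck_on_SucI[OF assms(1) _ *])
    fix x assume x: "x \<in> S"
    then have gx: "g x \<in> T" using assms(4) by auto
    have "((\<lambda>x. f (g x)) has_derivative (\<lambda>v. frechet_derivative f (at (g x)) (frechet_derivative g (at x) v))) (at x)"
      by (rule has_derivative_compose[OF Ck_on_has_derivative[OF Suc.prems(2) x]
            Ck_on_has_derivative[OF Suc.prems(1) gx]])
    then show "((\<lambda>x. f (g x)) has_derivative (\<lambda>v. \<Sum>i\<in>Basis. (frechet_derivative g (at x) v \<bullet> i) *\<^sub>R
      frechet_derivative f (at (g x)) i)) (at x)"
      using Suc.prems(1) gx by (subst (asm) frechet_derivative_euclidean) auto
  qed
qed

lemma Ck_on_inverse: "Ck_on k (inverse :: real \<Rightarrow> real) (- {0})"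
proof (induction k)
  case 0
  then show ?case by (auto intro!: continuous_intros)
next
  case (Suc k)
  \<comment> \<open>The derivative is again a product of inverses, so the induction closes on
    itself.\<close>
  have "Ck_on k (\<lambda>x::real. (- v) * (inverse x * inverse x)) (- {0})" for v
    by (intro Ck_on_bilinear[OF bounded_bilinear_mult] Ck_on_const Suc) auto
  then show ?case
    by (intro Ck_on_SucI[where f' = "\<lambda>x v. (- v) * (inverse x * inverse x)"])
      (auto intro!: derivative_eq_intros)
qed

section \<open>Closure properties of smooth maps, up to matrix inversion\<close>

lemma smooth_on_cong:
  "smooth_on f S \<Longrightarrow> open S \<Longrightarrow> (\<And>x. x \<in> S \<Longrightarrow> f x = g x) \<Longrightarrow> smooth_on g S"
  unfolding smooth_on_def using Ck_on_cong by blast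

lemma smooth_on_subset: "smooth_on f S \<Longrightarrow> T \<subseteq> S \<Longrightarrow> smooth_on f T"
  unfolding smooth_on_def using Ck_on_subset by blast

lemma smooth_on_Un:
  "smooth_on f S \<Longrightarrow> smooth_on f T \<Longrightarrow> open S \<Longrightarrow> open T \<Longrightarrow> smooth_on f (S \<union> T)"
  unfolding smooth_on_def using Ck_on_Union[of "{S, T}"] by auto

lemma smooth_on_continuous_on: "smooth_on f S \<Longrightarrow> continuous_on S f"
  unfolding smooth_on_def using Ck_on_continuous_on by blast

lemma smooth_on_has_derivative:
  "smooth_on f S \<Longrightarrow> x \<in> S \<Longrightarrow> (f has_derivative frechet_derivative f (at x)) (at x)"
  unfolding smooth_on_def using Ck_on_has_derivative by blast

lemma smooth_on_differentiable: "smooth_on f S \<Longrightarrow> x \<in> S \<Longrightarrow> f differentiable (at x)"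
  using smooth_on_has_derivative differentiable_def by blast

lemma smooth_on_frechet_derivative:
  "smooth_on f S \<Longrightarrow> smooth_on (\<lambda>x. frechet_derivative f (at x) v) S"
  unfolding smooth_on_def by (metis Ck_on.simps(2))

lemma smooth_on_const: "open S \<Longrightarrow> smooth_on (\<lambda>x. c) S"
  unfolding smooth_on_def by (simp add: Ck_on_const)

lemma smooth_on_bounded_linear: "open S \<Longrightarrow> bounded_linear f \<Longrightarrow> smooth_on f S"
  unfolding smooth_on_def by (simp add: Ck_on_bounded_linear)

lemma smooth_on_ident: "open S \<Longrightarrow> smooth_on (\<lambda>x. x) S"
  by (simp add: smooth_on_bounded_linear bounded_linear_ident)

lemma smooth_on_add:
  "open S \<Longrightarrow> smooth_on f S \<Longrightarrow> smooth_on g S \<Longrightarrow> smooth_on (\<lambda>x. f x + g x) S"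
  unfolding smooth_on_def by (simp add: Ck_on_add)

lemma smooth_on_bilinear:
  "bounded_bilinear B \<Longrightarrow> open S \<Longrightarrow> smooth_on f S \<Longrightarrow> smooth_on g S \<Longrightarrow> smooth_on (\<lambda>x. B (f x) (g x)) S"
  unfolding smooth_on_def by (simp add: Ck_on_bilinear)

lemmas smooth_on_mult = smooth_on_bilinear[OF bounded_bilinear_mult]
lemmas smooth_on_scaleR = smooth_on_bilinear[OF bounded_bilinear_scaleR]

lemma smooth_on_diff:
  assumes "open S" "smooth_on f S" "smooth_on g S"
  shows "smooth_on (\<lambda>x. f x - g x) S"
  using smooth_on_add[OF assms(1,2) smooth_on_scaleR[OF assms(1) smooth_on_const[OF assms(1), of "-1"] assms(3)]]
  by simp

lemma smooth_on_sum:
  "open S \<Longrightarrow> (\<And>i. i \<in> I \<Longrightarrow> smooth_on (f i) S) \<Longrightarrow> smooth_on (\<lambda>x. \<Sum>i\<in>I. f i x) S"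
  unfolding smooth_on_def by (simp add: Ck_on_sum)

lemma smooth_on_prod:
  fixes f :: "'i \<Rightarrow> 'a::real_normed_vector \<Rightarrow> real"
  assumes "open S" "\<And>i. i \<in> I \<Longrightarrow> smooth_on (f i) S"
  shows "smooth_on (\<lambda>x. \<Prod>i\<in>I. f i x) S"
  using assms
  by (induction I rule: infinite_finite_induct) (auto intro!: smooth_on_const smooth_on_mult)

lemma smooth_on_compose:
  fixes f :: "'b::euclidean_space \<Rightarrow> 'c::real_normed_vector" and g :: "'a::real_normed_vector \<Rightarrow> 'b"
  assumes "open S" "smooth_on f T" "smooth_on g S" "g ` S \<subseteq> T"
  shows "smooth_on (\<lambda>x. f (g x)) S"
  using assms unfolding smooth_on_def by (blast intro: Ck_on_compose)

lemma smooth_on_divide: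
  fixes f g :: "'a::real_normed_vector \<Rightarrow> real"
  assumes "open S" "smooth_on f S" "smooth_on g S" "\<And>x. x \<in> S \<Longrightarrow> g x \<noteq> 0"
  shows "smooth_on (\<lambda>x. f x / g x) S"
proof -
  have "smooth_on (inverse :: real \<Rightarrow> real) (- {0})" by (simp add: smooth_on_def Ck_on_inverse)
  then have "smooth_on (\<lambda>x. inverse (g x)) S"
    by (rule smooth_on_compose[OF assms(1) _ assms(3)]) (use assms(4) in auto)
  then show ?thesis using assms smooth_on_mult by (simp add: divide_inverse)
qed

text \<open>\<open>L\<close> is read as the bilinear map sending \<open>r\<close> and
  \<open>y\<close> to \<open>r *\<^sub>R L y\<close>, taken at \<open>r = 1\<close>; in this form
  \<open>f\<close> may have values in any normed space, whereas \<open>smooth_on_compose\<close>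
  takes them in a Euclidean one.\<close>

lemma smooth_on_bounded_linear_compose:
  assumes "open S" "bounded_linear L" "smooth_on f S"
  shows "smooth_on (\<lambda>x. L (f x)) S"
proof -
  have "bounded_bilinear (\<lambda>(r::real) y. r *\<^sub>R L y)"
    by (rule bounded_bilinear.comp[OF bounded_bilinear_scaleR bounded_linear_ident assms(2)])
  from smooth_on_bilinear[OF this assms(1) smooth_on_const[OF assms(1), of 1] assms(3)]
  show ?thesis by simp
qed

lemma smooth_on_vec_nth: "open S \<Longrightarrow> smooth_on f S \<Longrightarrow> smooth_on (\<lambda>x. f x $ i) S"
  using smooth_on_bounded_linear_compose[OF _ bounded_linear_vec_nth] .

lemma smooth_on_vec_lambda:
  fixes f :: "'n::finite \<Rightarrow> 'a::real_normed_vector \<Rightarrow> 'b::euclidean_space"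
  assumes "open S" "\<And>i. smooth_on (f i) S"
  shows "smooth_on (\<lambda>x. \<chi> i. f i x) S"
proof -
  have "bounded_linear (axis i :: 'b \<Rightarrow> 'b ^ 'n)" for i
    unfolding linear_conv_bounded_linear[symmetric]
    by (auto intro!: linearI simp: axis_def vec_eq_iff)
  then have "smooth_on (\<lambda>x. \<Sum>i\<in>UNIV. axis i (f i x) :: 'b ^ 'n) S"
    by (intro smooth_on_sum assms(1) smooth_on_bounded_linear_compose[OF assms(1) _ assms(2)])
  moreover have "(\<Sum>i\<in>UNIV. axis i (f i x)) = (\<chi> i. f i x)" for x
    by (simp add: vec_eq_iff axis_def)
  ultimately show ?thesis by simp
qed

lemma bounded_bilinear_matrix_vector_mult:
  "bounded_bilinear (\<lambda>(A::real^'n::finite^'m::finite) x. A *v x)"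
  unfolding bilinear_conv_bounded_bilinear[symmetric] bilinear_def
  by (auto intro!: linearI simp: matrix_vector_right_distrib matrix_vector_mult_add_rdistrib
      scaleR_matrix_vector_assoc matrix_vector_mult_scaleR)

lemmas smooth_on_matrix_vector_mult = smooth_on_bilinear[OF bounded_bilinear_matrix_vector_mult]

lemma smooth_on_matrix_iff:
  fixes M :: "'a::real_normed_vector \<Rightarrow> real^'n::finite^'m::finite"
  assumes "open S"
  shows "smooth_on M S \<longleftrightarrow> (\<forall>v. smooth_on (\<lambda>x. M x *v v) S)"
proof safe
  fix v assume "smooth_on M S"
  then show "smooth_on (\<lambda>x. M x *v v) S"
    using assms by (intro smooth_on_matrix_vector_mult smooth_on_const)
next
  assume *: "\<forall>v. smooth_on (\<lambda>x. M x *v v) S"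
  have "smooth_on (\<lambda>x. \<chi> i j. (M x *v axis j 1) $ i) S"
    using * assms by (intro smooth_on_vec_lambda smooth_on_vec_nth) auto
  then show "smooth_on M S"
    by (simp add: matrix_vector_mult_basis column_def)
qed

lemma matrix_inv_right: "invertible A \<Longrightarrow> A ** matrix_inv A = mat 1"
  unfolding invertible_def matrix_inv_def by (rule someI_ex[THEN conjunct1])

text \<open>Cramer's rule: the inverse applied to a fixed \<open>b\<close> has quotients of
  determinants as entries, and determinants are polynomials in the smooth entries of
  \<open>M\<close>.\<close>

lemma smooth_on_matrix_inv:
  fixes M :: "'a::real_normed_vector \<Rightarrow> real^'n::finite^'n"
  assumes S: "open S" and M: "smooth_on M S" and inv: "\<And>x. x \<in> S \<Longrightarrow> invertible (M x)"
  shows "smooth_on (\<lambda>x. matrix_inv (M x)) S"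
proof -
  have det: "smooth_on (\<lambda>x. det (N x)) S" if "\<And>i j. smooth_on (\<lambda>x. N x $ i $ j) S"
    for N :: "'a \<Rightarrow> real^'n^'n"
    unfolding det_def
    using S that by (intro smooth_on_sum smooth_on_mult smooth_on_prod smooth_on_const) auto
  have Mij: "smooth_on (\<lambda>x. M x $ i $ j) S" for i j
    using smooth_on_vec_nth[OF S smooth_on_vec_nth[OF S M]] .
  have "smooth_on (\<lambda>x. matrix_inv (M x) *v b) S" for b
  proof (rule smooth_on_cong[OF _ S])
    show "smooth_on (\<lambda>x. \<chi> k. det (\<chi> i j. if j = k then b $ i else M x $ i $ j) / det (M x)) S"
    proof (intro smooth_on_vec_lambda smooth_on_divide det S)
      fix k i j
      show "smooth_on (\<lambda>x. (\<chi> i j. if j = k then b $ i else M x $ i $ j) $ i $ j) S"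
        using Mij S by (cases "j = k") (auto intro: smooth_on_const)
      show "smooth_on (\<lambda>x. M x $ i $ j) S" by (rule Mij)
    qed (use inv invertible_det_nz in blast)
    fix x assume "x \<in> S"
    then have "invertible (M x)" by (rule inv)
    then have *: "M x *v (matrix_inv (M x) *v b) = b" "det (M x) \<noteq> 0"
      using invertible_det_nz by (auto simp: matrix_vector_mul_assoc matrix_inv_right)
    show "(\<chi> k. det (\<chi> i j. if j = k then b $ i else M x $ i $ j) / det (M x)) = matrix_inv (M x) *v b"
      using cramer[OF *(2), THEN iffD1, OF *(1)] by simp
  qed
  then show ?thesis by (simp add: smooth_on_matrix_iff[OF S])
qed

text \<open>The second difference is the increment of a function of one variable. After subtraction
  of the expected term this is \<open>\<phi>\<close>, whose derivative is the difference of two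
  linearisation errors at \<open>x\<close> of the derivative in direction \<open>u\<close>; the mean
  value inequality supplies the second factor \<open>s\<close>.\<close>

lemma second_difference_quotient:
  fixes f :: "'a::real_normed_vector \<Rightarrow> 'b::real_normed_vector"
  assumes "open S" "x \<in> S" "\<And>y. y \<in> S \<Longrightarrow> f differentiable (at y)"
    and L: "((\<lambda>y. frechet_derivative f (at y) u) has_derivative L) (at x)" and "e > 0"
  shows "\<exists>d>0. \<forall>s. 0 < s \<and> s < d \<longrightarrow>
    norm (f (x + s *\<^sub>R u + s *\<^sub>R v) - f (x + s *\<^sub>R u) - f (x + s *\<^sub>R v) + f x - s\<^sup>2 *\<^sub>R L v) \<le> e * s\<^sup>2"
proof -
  define D where "D y = frechet_derivative f (at y) u" for y
  define c where "c = norm u + norm v"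
  have c: "c \<ge> 0" by (simp add: c_def)
  \<comment> \<open>The final estimate is \<open>2 * c * e' * s\<^sup>2\<close>; the added 1 covers
    the case \<open>u = v = 0\<close>, where \<open>c\<close> vanishes.\<close>
  define e' where "e' = e / (2 * c + 1)"
  have e': "e' > 0" using \<open>e > 0\<close> c by (simp add: e'_def)
  interpret L: bounded_linear L using L by (rule has_derivative_bounded_linear)
  from L obtain d1 where d1: "d1 > 0"
    "\<And>y. norm (y - x) < d1 \<Longrightarrow> norm (D y - D x - L (y - x)) \<le> e' * norm (y - x)"
    using e' unfolding has_derivative_at_alt D_def by blast
  from assms(1,2) obtain d2 where d2: "d2 > 0" "\<And>y. dist y x < d2 \<Longrightarrow> y \<in> S"
    unfolding open_dist by blast
  define d where "d = min d1 d2 / (c + 1)"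
  have "d > 0" using d1 d2 c by (simp add: d_def)
  moreover have "norm (f (x + s *\<^sub>R u + s *\<^sub>R v) - f (x + s *\<^sub>R u) - f (x + s *\<^sub>R v) + f x - s\<^sup>2 *\<^sub>R L v) \<le> e * s\<^sup>2"
    if s: "0 < s" "s < d" for s
  proof -
    have sc: "s * c < min d1 d2"
    proof -
      have "s * c \<le> s * (c + 1)" using s c by (simp add: mult_left_mono)
      also have "\<dots> < d * (c + 1)" using s c by (intro mult_strict_right_mono) auto
      also have "\<dots> = min d1 d2" using c by (simp add: d_def)
      finally show ?thesis .
    qed
    have near: "norm (r *\<^sub>R u + q *\<^sub>R v) \<le> s * c" if "0 \<le> r" "r \<le> s" "0 \<le> q" "q \<le> s" for r q
    proof -
      have "norm (r *\<^sub>R u + q *\<^sub>R v) \<le> r * norm u + q * norm v"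
        using that norm_triangle_ineq[of "r *\<^sub>R u" "q *\<^sub>R v"] by simp
      also have "\<dots> \<le> s * norm u + s * norm v" using that by (intro add_mono mult_right_mono) auto
      finally show ?thesis by (simp add: c_def algebra_simps)
    qed
    have in_S: "x + (r *\<^sub>R u + q *\<^sub>R v) \<in> S" if "0 \<le> r" "r \<le> s" "0 \<le> q" "q \<le> s" for r q
      using near[OF that] sc d2(2)[of "x + (r *\<^sub>R u + q *\<^sub>R v)"] by (simp add: dist_norm)
    have lin: "norm (D (x + (r *\<^sub>R u + q *\<^sub>R v)) - D x - L (r *\<^sub>R u + q *\<^sub>R v)) \<le> e' * (s * c)"
      if "0 \<le> r" "r \<le> s" "0 \<le> q" "q \<le> s" for r q
    proof -
      have "norm (D (x + (r *\<^sub>R u + q *\<^sub>R v)) - D x - L (r *\<^sub>R u + q *\<^sub>R v)) \<le> e' * norm (r *\<^sub>R u + q *\<^sub>R v)"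
        using d1(2)[of "x + (r *\<^sub>R u + q *\<^sub>R v)"] near[OF that] sc by simp
      also have "\<dots> \<le> e' * (s * c)" using near[OF that] e' by (intro mult_left_mono) auto
      finally show ?thesis .
    qed
    define \<phi> where "\<phi> r = f (x + (r *\<^sub>R u + s *\<^sub>R v)) - f (x + (r *\<^sub>R u + 0 *\<^sub>R v)) - (r * s) *\<^sub>R L v" for r
    define \<phi>' where "\<phi>' r = D (x + (r *\<^sub>R u + s *\<^sub>R v)) - D (x + (r *\<^sub>R u + 0 *\<^sub>R v)) - s *\<^sub>R L v" for r
    have df: "((\<lambda>r. f (x + (r *\<^sub>R u + q *\<^sub>R v))) has_derivative (\<lambda>h. h *\<^sub>R D (x + (r *\<^sub>R u + q *\<^sub>R v)))) (at r within {0..s})"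
      if "0 \<le> r" "r \<le> s" "0 \<le> q" "q \<le> s" for r q
    proof -
      let ?y = "x + (r *\<^sub>R u + q *\<^sub>R v)"
      have f: "(f has_derivative frechet_derivative f (at ?y)) (at ?y)"
        using assms(3)[OF in_S[OF that]] frechet_derivative_works by blast
      have "((\<lambda>r. f (x + (r *\<^sub>R u + q *\<^sub>R v))) has_derivative (\<lambda>h. frechet_derivative f (at ?y) (h *\<^sub>R u))) (at r within {0..s})"
        by (rule has_derivative_compose[where f = "\<lambda>r. x + (r *\<^sub>R u + q *\<^sub>R v)" and g = f, OF _ f])
          (auto intro!: derivative_eq_intros)
      then show ?thesis
        using linear_cmul[OF has_derivative_linear[OF f]] by (simp add: D_def)
    qed
    have "(\<phi> has_derivative (\<lambda>h. h *\<^sub>R \<phi>' r)) (at r within {0..s})" if "r \<in> {0..s}" for r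
    proof -
      have "((\<lambda>r. (r * s) *\<^sub>R L v) has_derivative (\<lambda>h. h *\<^sub>R s *\<^sub>R L v)) (at r within {0..s})"
        by (auto intro!: derivative_eq_intros)
      from has_derivative_diff[OF has_derivative_diff[OF df[of r s] df[of r 0]] this]
      show ?thesis using that s by (simp add: \<phi>_def[abs_def] \<phi>'_def scaleR_diff_right)
    qed
    moreover have "onorm (\<lambda>h. h *\<^sub>R \<phi>' r) \<le> 2 * e' * (s * c)" if "r \<in> {0..s}" for r
    proof -
      have "\<phi>' r = (D (x + (r *\<^sub>R u + s *\<^sub>R v)) - D x - L (r *\<^sub>R u + s *\<^sub>R v))
        - (D (x + (r *\<^sub>R u + 0 *\<^sub>R v)) - D x - L (r *\<^sub>R u + 0 *\<^sub>R v))"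
        by (simp add: \<phi>'_def L.add L.scaleR)
      also have "norm \<dots> \<le> e' * (s * c) + e' * (s * c)"
        using that s by (intro order_trans[OF norm_triangle_ineq4] add_mono lin) auto
      finally have *: "norm (\<phi>' r) \<le> 2 * e' * (s * c)" by (simp add: mult_ac)
      show ?thesis
      proof (rule onorm_le)
        show "norm (h *\<^sub>R \<phi>' r) \<le> 2 * e' * (s * c) * norm h" for h
          using mult_right_mono[OF *, of "norm h"] by (simp add: mult.commute)
      qed
    qed
    ultimately have "norm (\<phi> s - \<phi> 0) \<le> 2 * e' * (s * c) * norm (s - 0)"
      using s by (intro differentiable_bound[where S = "{0..s}" and f' = "\<lambda>r h. h *\<^sub>R \<phi>' r"]) auto
    also have "\<dots> = (2 * c * e') * s\<^sup>2" using s by (simp add: power2_eq_square)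
    also have "\<dots> \<le> e * s\<^sup>2"
    proof (intro mult_right_mono)
      have "2 * c * e \<le> e * (2 * c + 1)" using \<open>e > 0\<close> by (simp add: algebra_simps)
      then show "2 * c * e' \<le> e" using c by (simp add: e'_def divide_simps)
    qed auto
    also have "\<phi> s - \<phi> 0 = f (x + s *\<^sub>R u + s *\<^sub>R v) - f (x + s *\<^sub>R u) - f (x + s *\<^sub>R v) + f x - s\<^sup>2 *\<^sub>R L v"
      by (simp add: \<phi>_def algebra_simps power2_eq_square)
    finally show ?thesis .
  qed
  ultimately show ?thesis by blast
qed

text \<open>The second difference is unchanged when \<open>u\<close> and \<open>v\<close> are
  exchanged, so both iterated derivatives are its limit after division by
  \<open>s\<^sup>2\<close>.\<close>

lemma second_derivative_symmetric:
  fixes f :: "'a::real_normed_vector \<Rightarrow> 'b::real_normed_vector"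
  assumes S: "open S" "smooth_on f S" "x \<in> S"
  shows "frechet_derivative (\<lambda>y. frechet_derivative f (at y) u) (at x) v =
    frechet_derivative (\<lambda>y. frechet_derivative f (at y) v) (at x) u" (is "?L u v = ?L v u")
proof -
  have D: "((\<lambda>y. frechet_derivative f (at y) w) has_derivative ?L w) (at x)" for w
    using smooth_on_has_derivative[OF smooth_on_frechet_derivative[OF S(2)] S(3)] .
  let ?\<Delta> = "\<lambda>s. f (x + s *\<^sub>R u + s *\<^sub>R v) - f (x + s *\<^sub>R u) - f (x + s *\<^sub>R v) + f x"
  have "norm (?L u v - ?L v u) \<le> 2 * e" if "e > 0" for e
  proof -
    obtain d where d: "d > 0" "\<And>s. 0 < s \<Longrightarrow> s < d \<Longrightarrow> norm (?\<Delta> s - s\<^sup>2 *\<^sub>R ?L u v) \<le> e * s\<^sup>2"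
      using second_difference_quotient[OF S(1,3) smooth_on_differentiable[OF S(2)] D \<open>e > 0\<close>, of u v]
      by blast
    obtain d' where d': "d' > 0" "\<And>s. 0 < s \<Longrightarrow> s < d' \<Longrightarrow> norm (?\<Delta> s - s\<^sup>2 *\<^sub>R ?L v u) \<le> e * s\<^sup>2"
      using second_difference_quotient[OF S(1,3) smooth_on_differentiable[OF S(2)] D \<open>e > 0\<close>, of v u]
      by (auto simp: algebra_simps)
    define s where "s = min d d' / 2"
    have s: "0 < s" "s < d" "s < d'" using d(1) d'(1) by (auto simp: s_def)
    have "s\<^sup>2 * norm (?L u v - ?L v u) = norm ((?\<Delta> s - s\<^sup>2 *\<^sub>R ?L v u) - (?\<Delta> s - s\<^sup>2 *\<^sub>R ?L u v))"
      by (simp add: scaleR_diff_right[symmetric] del: scaleR_diff_right)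
    also have "\<dots> \<le> e * s\<^sup>2 + e * s\<^sup>2"
      by (intro order_trans[OF norm_triangle_ineq4] add_mono d d' s)
    finally have "s\<^sup>2 * norm (?L u v - ?L v u) \<le> s\<^sup>2 * (2 * e)" by (simp add: algebra_simps)
    then show ?thesis using s(1) by simp
  qed
  then have "norm (?L u v - ?L v u) \<le> 0 + e" if "e > 0" for e using that[THEN half_gt_zero] by fastforce
  then have "norm (?L u v - ?L v u) \<le> 0" by (rule field_le_epsilon)
  then show ?thesis by simp
qed

lemma smooth_on_exp_neg_inverse:
  "smooth_on (\<lambda>s::real. if s > 0 then exp (- inverse s) else 0) UNIV"
proof -
  \<comment> \<open>The function wanted is \<open>g 0\<close>. The whole family is closed under
    differentiation: the derivative of \<open>g n\<close> is
    \<open>g (n + 2) - n * g (n + 1)\<close>, so one induction on the order, for all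
    \<open>n\<close> at once, suffices.\<close>
  define g where "g n s = (if s > 0 then inverse s ^ n * exp (- inverse s) else 0)" for n and s :: real
  have lim: "(g n \<longlongrightarrow> 0) (at 0)" for n
  proof -
    have "((\<lambda>s::real. inverse s ^ n / exp (inverse s)) \<longlongrightarrow> 0) (at_right 0)"
      by (rule filterlim_compose[OF tendsto_power_div_exp_0 filterlim_inverse_at_top_right])
    then have "(g n \<longlongrightarrow> 0) (at_right 0)"
      by (rule Lim_transform_eventually)
        (auto simp: g_def exp_minus divide_inverse eventually_at_right[of 0 1] intro!: exI[of _ 1])
    moreover have "(g n \<longlongrightarrow> 0) (at_left 0)"
      by (rule Lim_transform_eventually[OF tendsto_const])
        (auto simp: g_def eventually_at_left[of "-1" 0] intro!: exI[of _ "-1"])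
    ultimately show ?thesis by (simp add: filterlim_split_at)
  qed
  have der: "(g n has_real_derivative (g (n + 2) s - n * g (n + 1) s)) (at s)" for n s
  proof -
    consider "s > 0" | "s < 0" | "s = 0" by linarith
    then show ?thesis
    proof cases
      case 1
      have "((\<lambda>s. inverse s ^ n) has_real_derivative - (n * inverse s ^ (n + 1))) (at s)"
        using DERIV_power[OF DERIV_inverse[of s UNIV], of n] 1
        by (cases n) (auto simp: power2_eq_square algebra_simps)
      moreover have "((\<lambda>s. exp (- inverse s)) has_real_derivative (inverse s)\<^sup>2 * exp (- inverse s)) (at s)"
        using 1 by (auto intro!: derivative_eq_intros simp: power2_eq_square)
      ultimately have "((\<lambda>s. inverse s ^ n * exp (- inverse s)) has_real_derivative (g (n + 2) s - n * g (n + 1) s)) (at s)"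
        using 1 by (auto dest: DERIV_mult simp: g_def power2_eq_square algebra_simps)
      then show ?thesis
        by (rule has_field_derivative_transform_within_open[where S = "{0<..}"])
          (use 1 in \<open>auto simp: g_def\<close>)
    next
      case 2
      have "((\<lambda>s. 0) has_real_derivative (g (n + 2) s - n * g (n + 1) s)) (at s)"
        using 2 by (simp add: g_def)
      then show ?thesis
        by (rule has_field_derivative_transform_within_open[where S = "{..<0}"])
          (use 2 in \<open>auto simp: g_def\<close>)
    next
      case 3
      \<comment> \<open>As \<open>g n 0 = 0\<close>, the difference quotient at 0 is the next member
        of the family, which tends to 0 by \<open>lim\<close>.\<close>
      have "(\<lambda>h. (g n (0 + h) - g n 0) / h) = g (n + 1)"
        by (auto simp: g_def fun_eq_iff divide_inverse)
      then show ?thesis using lim[of "n + 1"] 3 by (simp add: DERIV_def g_def)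
    qed
  qed
  have "Ck_on k (g n) UNIV" for k n
  proof (induction k arbitrary: n)
    case 0
    show ?case using DERIV_isCont[OF der] by (simp add: continuous_at_imp_continuous_on)
  next
    case (Suc k)
    have "Ck_on k (\<lambda>s. v * (g (n + 2) s + (- real n) * g (n + 1) s)) UNIV" for v
      by (intro Ck_on_bilinear[OF bounded_bilinear_mult] Ck_on_add Ck_on_const Suc) auto
    then show ?case
      by (intro Ck_on_SucI[where f' = "\<lambda>s v. v * (g (n + 2) s + (- real n) * g (n + 1) s)"])
        (use der in \<open>auto simp: has_field_derivative_def mult.commute[of _ "_ - _"]\<close>)
  qed
  then have "smooth_on (g 0) UNIV" by (simp add: smooth_on_def)
  then show ?thesis by (simp add: g_def[abs_def] cong: if_cong)
qed

section \<open>Total differential equations\<close>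

lemma smooth_on_bounded_image:
  assumes "smooth_on g U" "compact K" "K \<subseteq> U"
  shows "\<exists>C\<ge>0. \<forall>x\<in>K. norm (g x) \<le> C"
proof -
  have "compact (g ` K)"
    using assms by (intro compact_continuous_image) (auto intro: continuous_on_subset smooth_on_continuous_on)
  then obtain C where "\<forall>y\<in>g ` K. norm y \<le> C" using compact_imp_bounded bounded_iff by metis
  then show ?thesis by (intro exI[of _ "max C 0"]) auto
qed

text \<open>Smoothness yields bounds for one fixed direction at a time; this passes from the
  finitely many basis vectors to a bound uniform in the direction. The factor \<open>r\<close>
  carries the distance terms of Lipschitz and Taylor estimates.\<close>

lemma norm_linear_le_sum_Basis:
  fixes Q :: "'a::euclidean_space \<Rightarrow> 'b::real_normed_vector"
  assumes "\<And>v. Q v = (\<Sum>i\<in>Basis. (v \<bullet> i) *\<^sub>R Q i)" "\<And>i. i \<in> Basis \<Longrightarrow> norm (Q i) \<le> C i * r"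
  shows "norm (Q v) \<le> sum C Basis * r * norm v"
proof -
  have "norm (Q v) \<le> (\<Sum>i\<in>Basis. norm ((v \<bullet> i) *\<^sub>R Q i))" by (subst assms(1)) (rule norm_sum)
  also have "\<dots> \<le> (\<Sum>i\<in>Basis. norm v * (C i * r))"
    using assms(2) Basis_le_norm by (intro sum_mono) (auto intro!: mult_mono)
  also have "\<dots> = sum C Basis * r * norm v" by (simp add: sum_distrib_left sum_distrib_right mult_ac)
  finally show ?thesis .
qed

lemma smooth_on_bounded_derivative:
  fixes g :: "'a::euclidean_space \<Rightarrow> 'b::real_normed_vector"
  assumes "smooth_on g U" "compact K" "K \<subseteq> U"
  shows "\<exists>C\<ge>0. \<forall>x\<in>K. \<forall>w. norm (frechet_derivative g (at x) w) \<le> C * norm w"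
proof -
  have "\<forall>i. \<exists>C\<ge>0. \<forall>x\<in>K. norm (frechet_derivative g (at x) i) \<le> C"
    using smooth_on_bounded_image[OF smooth_on_frechet_derivative[OF assms(1)] assms(2,3)] by blast
  then obtain C where C: "\<And>i. C i \<ge> 0" "\<And>i x. x \<in> K \<Longrightarrow> norm (frechet_derivative g (at x) i) \<le> C i"
    by metis
  have "norm (frechet_derivative g (at x) w) \<le> sum C Basis * 1 * norm w" if "x \<in> K" for x w
    using C(2)[OF that] that assms(3)
    by (intro norm_linear_le_sum_Basis frechet_derivative_euclidean smooth_on_differentiable[OF assms(1)]) auto
  then show ?thesis using C(1) by (intro exI[of _ "sum C Basis"]) (auto intro: sum_nonneg)
qed

lemma smooth_on_Lipschitz:
  fixes g :: "'a::euclidean_space \<Rightarrow> 'b::real_normed_vector"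
  assumes "smooth_on g U" "compact K" "convex K" "K \<subseteq> U"
  shows "\<exists>C\<ge>0. \<forall>x\<in>K. \<forall>y\<in>K. norm (g x - g y) \<le> C * norm (x - y)"
proof -
  obtain C where C: "C \<ge> 0" "\<And>x w. x \<in> K \<Longrightarrow> norm (frechet_derivative g (at x) w) \<le> C * norm w"
    using smooth_on_bounded_derivative[OF assms(1,2,4)] by blast
  have "norm (g x - g y) \<le> C * norm (x - y)" if "x \<in> K" "y \<in> K" for x y
    using assms(4) C(2) that
    by (intro differentiable_bound[OF assms(3), where f' = "\<lambda>x. frechet_derivative g (at x)"]
        has_derivative_at_withinI[OF smooth_on_has_derivative[OF assms(1)]] onorm_le) auto
  then show ?thesis using C(1) by blast
qed

text \<open>The derivative is Lipschitz on \<open>K\<close>, uniformly in the direction. On the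
  segment from \<open>x\<close> to \<open>y\<close> it therefore stays within a multiple of
  \<open>norm (y - x)\<close> of its value at \<open>x\<close>, and the mean value inequality
  contributes the second factor.\<close>

lemma smooth_on_Taylor:
  fixes g :: "'a::euclidean_space \<Rightarrow> 'b::real_normed_vector"
  assumes "smooth_on g U" "compact K" "convex K" "K \<subseteq> U"
  shows "\<exists>C\<ge>0. \<forall>x\<in>K. \<forall>y\<in>K.
    norm (g y - g x - frechet_derivative g (at x) (y - x)) \<le> C * (norm (y - x))\<^sup>2"
proof -
  let ?D = "\<lambda>x. frechet_derivative g (at x)"
  have "\<forall>i. \<exists>C\<ge>0. \<forall>x\<in>K. \<forall>y\<in>K. norm (?D x i - ?D y i) \<le> C * norm (x - y)"
    using smooth_on_Lipschitz[OF smooth_on_frechet_derivative[OF assms(1)] assms(2-4)] by blast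
  then obtain C where C: "\<And>i. C i \<ge> 0"
    "\<And>i x y. x \<in> K \<Longrightarrow> y \<in> K \<Longrightarrow> norm (?D x i - ?D y i) \<le> C i * norm (x - y)"
    by metis
  have S: "sum C Basis \<ge> 0" using C(1) by (auto intro: sum_nonneg)
  have lip: "norm (?D x w - ?D y w) \<le> sum C Basis * norm (x - y) * norm w" if "x \<in> K" "y \<in> K" for x y w
  proof (rule norm_linear_le_sum_Basis)
    fix v
    have "?D x v = (\<Sum>i\<in>Basis. (v \<bullet> i) *\<^sub>R ?D x i)" "?D y v = (\<Sum>i\<in>Basis. (v \<bullet> i) *\<^sub>R ?D y i)"
      using that assms(4) smooth_on_differentiable[OF assms(1)]
      by (blast intro!: frechet_derivative_euclidean)+
    then show "?D x v - ?D y v = (\<Sum>i\<in>Basis. (v \<bullet> i) *\<^sub>R (?D x i - ?D y i))"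
      by (simp add: scaleR_diff_right sum_subtractf)
  qed (use C(2) that in blast)
  have "norm (g y - g x - ?D x (y - x)) \<le> sum C Basis * (norm (y - x))\<^sup>2" if xy: "x \<in> K" "y \<in> K" for x y
  proof -
    have seg: "closed_segment x y \<subseteq> K" using assms(3) xy by (simp add: closed_segment_subset)
    have "norm (g y - g x - ?D x (y - x)) \<le> norm (y - x) * (sum C Basis * norm (y - x))"
    proof (rule differentiable_bound_linearization[where S = "closed_segment x y" and f' = ?D])
      show "x + t *\<^sub>R (y - x) \<in> closed_segment x y" if "t \<in> {0..1}" for t
        using that by (auto simp: in_segment algebra_simps intro!: exI[of _ t])
      show "(g has_derivative ?D z) (at z within closed_segment x y)" if "z \<in> closed_segment x y" for z
        using that seg assms(4)
        by (intro has_derivative_at_withinI[OF smooth_on_has_derivative[OF assms(1)]]) auto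
      show "onorm (?D z - ?D x) \<le> sum C Basis * norm (y - x)" if z: "z \<in> closed_segment x y" for z
      proof (rule onorm_le)
        fix w :: 'a
        have "norm (z - x) \<le> norm (y - x)"
          using z dist_in_closed_segment(1)[OF z] by (simp add: dist_norm norm_minus_commute)
        then have "sum C Basis * norm (z - x) * norm w \<le> sum C Basis * norm (y - x) * norm w"
          using S by (intro mult_right_mono mult_left_mono) auto
        then show "norm ((?D z - ?D x) w) \<le> sum C Basis * norm (y - x) * norm w"
          using lip[of z x w] seg z xy by auto
      qed
    qed auto
    then show ?thesis by (simp add: power2_eq_square mult_ac)
  qed
  then show ?thesis using S by blast
qed

text \<open>Differentiation in the base point preserves the linear dependence on \<open>v\<close>;
  estimates for the frame fields of basis vectors thus extend to all \<open>v\<close>.\<close>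

lemma frechet_derivative_linear_family:
  fixes G :: "'a::real_normed_vector \<Rightarrow> 'c::euclidean_space \<Rightarrow> 'b::real_normed_vector"
  assumes "open U" "\<And>x. x \<in> U \<Longrightarrow> linear (G x)" "\<And>v. smooth_on (\<lambda>x. G x v) U" "x \<in> U"
  shows "frechet_derivative (\<lambda>x. G x v) (at x) u =
    (\<Sum>i\<in>Basis. (v \<bullet> i) *\<^sub>R frechet_derivative (\<lambda>x. G x i) (at x) u)"
proof -
  have G: "G y v = (\<Sum>i\<in>Basis. (v \<bullet> i) *\<^sub>R G y i)" if "y \<in> U" for y
    using assms(2)[OF that]
    by (subst (1) euclidean_representation[of v, symmetric]) (simp add: linear_sum linear_cmul)
  have "((\<lambda>y. \<Sum>i\<in>Basis. (v \<bullet> i) *\<^sub>R G y i) has_derivative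
      (\<lambda>u. \<Sum>i\<in>Basis. (v \<bullet> i) *\<^sub>R frechet_derivative (\<lambda>x. G x i) (at x) u)) (at x)"
    by (intro has_derivative_sum has_derivative_scaleR_right smooth_on_has_derivative[OF assms(3,4)])
  then have "((\<lambda>x. G x v) has_derivative
      (\<lambda>u. \<Sum>i\<in>Basis. (v \<bullet> i) *\<^sub>R frechet_derivative (\<lambda>x. G x i) (at x) u)) (at x)"
    by (rule has_derivative_transform_within_open[OF _ assms(1,4)]) (simp add: G)
  from frechet_derivative_at[OF this] show ?thesis by metis
qed

lemma smooth_linear_family_bounds:
  fixes G :: "'a::euclidean_space \<Rightarrow> 'c::euclidean_space \<Rightarrow> 'b::real_normed_vector"
  assumes U: "open U" and lin: "\<And>x. x \<in> U \<Longrightarrow> linear (G x)" and sm: "\<And>v. smooth_on (\<lambda>x. G x v) U"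
    and K: "compact K" "convex K" "K \<subseteq> U"
  obtains C where "C > 0"
    "\<And>x v. x \<in> K \<Longrightarrow> norm (G x v) \<le> C * norm v"
    "\<And>x v w. x \<in> K \<Longrightarrow> norm (frechet_derivative (\<lambda>x. G x v) (at x) w) \<le> C * norm w * norm v"
    "\<And>x y v. x \<in> K \<Longrightarrow> y \<in> K \<Longrightarrow> norm (G x v - G y v) \<le> C * norm (x - y) * norm v"
    "\<And>x y v. x \<in> K \<Longrightarrow> y \<in> K \<Longrightarrow>
      norm (G y v - G x v - frechet_derivative (\<lambda>x. G x v) (at x) (y - x)) \<le> C * (norm (y - x))\<^sup>2 * norm v"
proof -
  let ?D = "\<lambda>v x. frechet_derivative (\<lambda>x. G x v) (at x)"
  obtain C1 where C1: "\<And>i. C1 i \<ge> 0" "\<And>i x. x \<in> K \<Longrightarrow> norm (G x i) \<le> C1 i"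
    using smooth_on_bounded_image[OF sm K(1,3)] by metis
  obtain C2 where C2: "\<And>i. C2 i \<ge> 0" "\<And>i x w. x \<in> K \<Longrightarrow> norm (?D i x w) \<le> C2 i * norm w"
    using smooth_on_bounded_derivative[OF sm K(1,3)] by metis
  obtain C3 where C3: "\<And>i. C3 i \<ge> 0"
    "\<And>i x y. x \<in> K \<Longrightarrow> y \<in> K \<Longrightarrow> norm (G x i - G y i) \<le> C3 i * norm (x - y)"
    using smooth_on_Lipschitz[OF sm K] by metis
  obtain C4 where C4: "\<And>i. C4 i \<ge> 0"
    "\<And>i x y. x \<in> K \<Longrightarrow> y \<in> K \<Longrightarrow> norm (G y i - G x i - ?D i x (y - x)) \<le> C4 i * (norm (y - x))\<^sup>2"
    using smooth_on_Taylor[OF sm K] by metis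
  \<comment> \<open>One constant serves all four estimates; the 1 makes it positive, so that it can
    be divided by.\<close>
  define C where "C = sum C1 Basis + sum C2 Basis + sum C3 Basis + sum C4 Basis + 1"
  have nonneg: "sum C1 Basis \<ge> 0" "sum C2 Basis \<ge> 0" "sum C3 Basis \<ge> 0" "sum C4 Basis \<ge> 0"
    using C1(1) C2(1) C3(1) C4(1) by (auto intro: sum_nonneg)
  have le: "c * r * norm v \<le> C * r * norm v"
    if "c \<in> {sum C1 Basis, sum C2 Basis, sum C3 Basis, sum C4 Basis}" "r \<ge> 0" for c r and v :: 'c
    using that nonneg by (intro mult_right_mono) (auto simp: C_def)
  have G: "G x v = (\<Sum>i\<in>Basis. (v \<bullet> i) *\<^sub>R G x i)" if "x \<in> K" for x v
    using lin[of x] K(3) that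
    by (subst (1) euclidean_representation[of v, symmetric]) (auto simp: linear_sum linear_cmul)
  have D: "?D v x w = (\<Sum>i\<in>Basis. (v \<bullet> i) *\<^sub>R ?D i x w)" if "x \<in> K" for x v w
    using that K(3) by (intro frechet_derivative_linear_family[OF U lin sm]) auto
  show ?thesis
  proof
    show "C > 0" using nonneg by (simp add: C_def)
    show "norm (G x v) \<le> C * norm v" if "x \<in> K" for x v
    proof -
      have "norm (G x v) \<le> sum C1 Basis * 1 * norm v"
        by (rule norm_linear_le_sum_Basis[of "G x", OF G[OF that]]) (use C1(2)[OF that] in simp)
      then show ?thesis using le[of "sum C1 Basis" 1 v] by simp
    qed
    show "norm (?D v x w) \<le> C * norm w * norm v" if "x \<in> K" for x v w
    proof -
      have "norm (?D v x w) \<le> sum C2 Basis * norm w * norm v"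
        by (rule norm_linear_le_sum_Basis[of "\<lambda>v. ?D v x w", OF D[OF that] C2(2)[OF that]])
      then show ?thesis using le[of "sum C2 Basis" "norm w" v] by simp
    qed
    show "norm (G x v - G y v) \<le> C * norm (x - y) * norm v" if "x \<in> K" "y \<in> K" for x y v
    proof -
      have "norm (G x v - G y v) \<le> sum C3 Basis * norm (x - y) * norm v"
      proof (rule norm_linear_le_sum_Basis)
        show "G x v - G y v = (\<Sum>i\<in>Basis. (v \<bullet> i) *\<^sub>R (G x i - G y i))" for v
          unfolding scaleR_diff_right sum_subtractf G[OF that(1), symmetric] G[OF that(2), symmetric] ..
      qed (use C3(2) that in blast)
      then show ?thesis using le[of "sum C3 Basis" "norm (x - y)" v] by simp
    qed
    show "norm (G y v - G x v - ?D v x (y - x)) \<le> C * (norm (y - x))\<^sup>2 * norm v" if "x \<in> K" "y \<in> K" for x y v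
    proof -
      have "norm (G y v - G x v - ?D v x (y - x)) \<le> sum C4 Basis * (norm (y - x))\<^sup>2 * norm v"
      proof (rule norm_linear_le_sum_Basis)
        show "G y v - G x v - ?D v x (y - x) = (\<Sum>i\<in>Basis. (v \<bullet> i) *\<^sub>R (G y i - G x i - ?D i x (y - x)))" for v
          unfolding scaleR_diff_right sum_subtractf
            G[OF that(1), symmetric] G[OF that(2), symmetric] D[OF that(1), symmetric] ..
      qed (use C4(2) that in blast)
      then show ?thesis using le[of "sum C4 Basis" "(norm (y - x))\<^sup>2" v] by simp
    qed
  qed
qed

text \<open>Instead of a short time interval, \<open>f\<close> is small: speed at most
  \<open>\<rho>\<close> keeps the iterates in the ball up to time 1, and the Lipschitz constant 1/2
  makes the integral operator a contraction. For \<open>f x = G x y\<close> both hold once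
  \<open>y\<close> is small.\<close>

lemma Picard_unit_interval:
  fixes f :: "'a::euclidean_space \<Rightarrow> 'a"
  assumes bound: "\<And>x. x \<in> cball x0 \<rho> \<Longrightarrow> norm (f x) \<le> \<rho>" and "\<rho> \<ge> 0"
    and lip: "\<And>x y. x \<in> cball x0 \<rho> \<Longrightarrow> y \<in> cball x0 \<rho> \<Longrightarrow> norm (f x - f y) \<le> norm (x - y) / 2"
  obtains z where "z 0 = x0" "\<And>t. t \<in> {0..1} \<Longrightarrow> z t \<in> cball x0 \<rho>"
    "\<And>t. t \<in> {0..1} \<Longrightarrow> (z has_vector_derivative f (z t)) (at t within {0..1::real})"
proof -
  let ?S = "PiC UNIV (\<lambda>_. cball x0 \<rho>) :: (real \<Rightarrow>\<^sub>C 'a) set"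
  have S_iff: "z \<in> ?S \<longleftrightarrow> (\<forall>t. apply_bcontfun z t \<in> cball x0 \<rho>)" for z
    by (simp add: mem_PiC_iff Pi_iff)
  define P where "P z t = x0 + integral {0..t} (\<lambda>s. f (apply_bcontfun z s))" for z :: "real \<Rightarrow>\<^sub>C 'a" and t
  have "continuous_on (cball x0 \<rho>) f"
  proof (rule lipschitz_on_continuous_on)
    show "(1/2)-lipschitz_on (cball x0 \<rho>) f"
      using lip by (intro lipschitz_onI) (auto simp: dist_norm)
  qed
  then have contf: "continuous_on T (\<lambda>s. f (apply_bcontfun z s))" if "z \<in> ?S" for T z
    by (rule continuous_on_compose2[of "cball x0 \<rho>" f]) (use that in \<open>auto simp only: S_iff image_subset_iff\<close>)
  have int: "(\<lambda>s. f (apply_bcontfun z s)) integrable_on {a..b}" if "z \<in> ?S" for z a b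
    using contf[OF that] by (intro integrable_continuous_real)
  have contP: "continuous_on (cbox 0 1) (P z)" if "z \<in> ?S" for z
    unfolding P_def cbox_interval
    by (intro continuous_on_add continuous_on_const indefinite_integral_continuous_1 int[OF that])
  \<comment> \<open>The complete space consists of bounded continuous functions on the whole line;
    \<open>clamp\<close> freezes the integral outside the unit interval and so makes it a member of
    that space.\<close>
  have "\<forall>z\<in>?S. \<exists>g::real \<Rightarrow>\<^sub>C 'a. \<forall>t. g t = P z (clamp 0 1 t)"
  proof
    fix z assume "z \<in> ?S"
    then obtain g :: "real \<Rightarrow>\<^sub>C 'a" where "\<And>t. g t = P z (clamp 0 1 t)"
      using continuous_on_cbox_bcontfunE[OF contP] by blast
    then show "\<exists>g::real \<Rightarrow>\<^sub>C 'a. \<forall>t. g t = P z (clamp 0 1 t)" by blast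
  qed
  from bchoice[OF this] obtain T :: "(real \<Rightarrow>\<^sub>C 'a) \<Rightarrow> real \<Rightarrow>\<^sub>C 'a"
    where T: "\<And>z t. z \<in> ?S \<Longrightarrow> T z t = P z (clamp 0 1 t)" by blast
  have clamp: "clamp 0 1 t \<in> {0..1}" for t :: real
    using clamp_in_interval[of 0 1 t] by simp
  have "\<exists>!z. z \<in> ?S \<and> T z = z"
  proof (rule Banach_fix[of _ "1/2"])
    show "complete ?S" by (simp add: complete_eq_closed closed_PiC)
    have "const_bcontfun x0 \<in> ?S" using \<open>\<rho> \<ge> 0\<close> by (simp add: S_iff)
    then show "?S \<noteq> {}" by blast
    show "T ` ?S \<subseteq> ?S"
    proof safe
      fix z assume z: "z \<in> ?S"
      have "norm (integral {0..t} (\<lambda>s. f (apply_bcontfun z s))) \<le> \<rho> * (t - 0)" if "t \<in> {0..1}" for t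
        using that z contf[OF z] bound by (intro integral_bound) (auto simp only: S_iff atLeastAtMost_iff)
      then have "P z t \<in> cball x0 \<rho>" if "t \<in> {0..1}" for t
        using that \<open>\<rho> \<ge> 0\<close> mult_left_mono[of t 1 \<rho>] by (fastforce simp: P_def dist_norm)
      then show "T z \<in> ?S" using T[OF z] clamp by (simp add: S_iff)
    qed
    show "dist (T z) (T w) \<le> 1/2 * dist z w" if zw: "z \<in> ?S" "w \<in> ?S" for z w
    proof (rule dist_bound)
      fix t :: real
      let ?t = "clamp 0 1 t"
      have "dist (T z t) (T w t) = norm (integral {0..?t} (\<lambda>s. f (apply_bcontfun z s) - f (apply_bcontfun w s)))"
        using T zw int by (simp add: P_def dist_norm integral_diff)
      also have "\<dots> \<le> (1/2 * dist z w) * (?t - 0)"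
      proof (intro integral_bound)
        fix s
        have "norm (f (apply_bcontfun z s) - f (apply_bcontfun w s)) \<le> dist (apply_bcontfun z s) (apply_bcontfun w s) / 2"
          using lip zw by (simp only: S_iff dist_norm)
        then show "norm (f (apply_bcontfun z s) - f (apply_bcontfun w s)) \<le> 1/2 * dist z w"
          using dist_bounded[of z s w] by linarith
      qed (use clamp[of t] contf zw in \<open>auto intro!: continuous_intros\<close>)
      also have "\<dots> \<le> (1/2 * dist z w) * 1" using clamp[of t] by (intro mult_left_mono) auto
      finally show "dist (T z t) (T w t) \<le> 1/2 * dist z w" by simp
    qed
  qed auto
  then obtain z where z: "z \<in> ?S" "T z = z" by blast
  have zP: "z t = P z t" if "t \<in> {0..1}" for t
    using T[OF z(1), of t] z(2) that by simp
  show ?thesis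
  proof
    show "z 0 = x0" using zP[of 0] by (simp add: P_def)
    show "z t \<in> cball x0 \<rho>" for t using z(1) by (simp only: S_iff)
    show "(z has_vector_derivative f (z t)) (at t within {0..1})" if "t \<in> {0..1}" for t
    proof (rule has_vector_derivative_transform[OF that])
      show "(P z has_vector_derivative f (z t)) (at t within {0..1})"
        unfolding P_def
        by (auto intro!: derivative_eq_intros integral_has_vector_derivative contf z that)
    qed (use zP in auto)
  qed
qed

text \<open>A Gronwall estimate read off at a maximum: where \<open>norm (d t)\<close> is largest,
  say at \<open>s\<close>, the mean value inequality gives
  \<open>norm (d s) \<le> norm (d s) / 2 + e\<close>.\<close>

lemma norm_le_of_derivative_le_half:
  fixes d :: "real \<Rightarrow> 'a::real_normed_vector"
  assumes d: "\<And>t. t \<in> {0..1} \<Longrightarrow> (d has_vector_derivative d' t) (at t within {0..1})"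
    and "d 0 = 0" and bound: "\<And>t. t \<in> {0..1} \<Longrightarrow> norm (d' t) \<le> norm (d t) / 2 + e"
  shows "norm (d 1) \<le> 2 * e"
proof -
  have "continuous_on {0..1} d"
    unfolding continuous_on_eq_continuous_within using has_vector_derivative_continuous[OF d] by blast
  then have "continuous_on {0..1} (\<lambda>t. norm (d t))" by (rule continuous_on_norm)
  then obtain s where s: "s \<in> {0..1}" "\<And>t. t \<in> {0..1} \<Longrightarrow> norm (d t) \<le> norm (d s)"
    using continuous_attains_sup[of "{0..1::real}" "\<lambda>t. norm (d t)"] by auto
  have "norm (d s - d 0) \<le> (norm (d s) / 2 + e) * norm (s - 0)"
  proof (rule differentiable_bound[where S = "{0..1}"])
    show "(d has_derivative (\<lambda>h. h *\<^sub>R d' t)) (at t within {0..1})" if "t \<in> {0..1}" for t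
      using d[OF that] by (simp add: has_vector_derivative_def)
    show "onorm (\<lambda>h. h *\<^sub>R d' t) \<le> norm (d s) / 2 + e" if "t \<in> {0..1}" for t
    proof (rule onorm_le)
      have "norm (d' t) \<le> norm (d s) / 2 + e" using bound[OF that] s(2)[OF that] by linarith
      then show "norm (h *\<^sub>R d' t) \<le> (norm (d s) / 2 + e) * norm h" for h
        by (simp add: mult.commute mult_left_mono)
    qed
  qed (use s in auto)
  moreover have "norm (d s) / 2 + e \<ge> 0"
    using order_trans[OF norm_ge_zero bound[of s]] s(1) by simp
  then have "(norm (d s) / 2 + e) * norm (s - 0) \<le> norm (d s) / 2 + e"
    using s(1) by (intro mult_left_le) auto
  ultimately have "norm (d s) \<le> norm (d s) / 2 + e" using \<open>d 0 = 0\<close> by simp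
  then show ?thesis using s(2)[of 1] by simp
qed

text \<open>The equation is solved along the rays \<open>t \<mapsto> t y\<close>. Moving the ray by \<open>k\<close>, the path
  \<open>q t = z t + t G (z t) k\<close> solves the ray equation for \<open>y + k\<close> up to an error of order \<open>|k|\<^sup>2\<close>:
  this is where the symmetry assumption enters.\<close>

lemma total_differential_equation:
  fixes G :: "'a::euclidean_space \<Rightarrow> 'c::euclidean_space \<Rightarrow> 'a"
  assumes U: "open U" "x0 \<in> U" and lin: "\<And>x. x \<in> U \<Longrightarrow> linear (G x)"
    and sm: "\<And>v. smooth_on (\<lambda>x. G x v) U"
    and sym: "\<And>x v w. x \<in> U \<Longrightarrow> frechet_derivative (\<lambda>x. G x w) (at x) (G x v)
      = frechet_derivative (\<lambda>x. G x v) (at x) (G x w)"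
  shows "\<exists>h \<delta>. \<delta> > 0 \<and> h 0 = x0 \<and> (\<forall>y\<in>ball 0 \<delta>. h y \<in> U \<and> (h has_derivative G (h y)) (at y))"
proof -
  let ?D = "\<lambda>v x. frechet_derivative (\<lambda>x. G x v) (at x)"
  obtain r where "r > 0" "cball x0 r \<subseteq> U" using U open_contains_cball by blast
  define \<rho> where "\<rho> = r / 2"
  have \<rho>: "\<rho> > 0" "cball x0 (2 * \<rho>) \<subseteq> U" using \<open>r > 0\<close> \<open>cball x0 r \<subseteq> U\<close> by (auto simp: \<rho>_def)
  \<comment> \<open>Solutions will stay within \<open>\<rho>\<close> of \<open>x0\<close>, the
    comparison paths \<open>q\<close> within twice that; the constants are taken on the larger
    ball.\<close>
  let ?K = "cball x0 (2 * \<rho>)"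
  obtain C where C: "C > 0"
    "\<And>x v. x \<in> ?K \<Longrightarrow> norm (G x v) \<le> C * norm v"
    "\<And>x v w. x \<in> ?K \<Longrightarrow> norm (?D v x w) \<le> C * norm w * norm v"
    "\<And>x y v. x \<in> ?K \<Longrightarrow> y \<in> ?K \<Longrightarrow> norm (G x v - G y v) \<le> C * norm (x - y) * norm v"
    "\<And>x y v. x \<in> ?K \<Longrightarrow> y \<in> ?K \<Longrightarrow>
      norm (G y v - G x v - ?D v x (y - x)) \<le> C * (norm (y - x))\<^sup>2 * norm v"
    using smooth_linear_family_bounds[OF U(1) lin sm compact_cball convex_cball \<rho>(2)] by blast
  \<comment> \<open>\<open>C * \<delta> \<le> 1 / 2\<close> gives the contraction. Picard asks for
    \<open>\<rho>\<close> only, but \<open>C * \<delta> \<le> \<rho> / 2\<close> ensures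
    \<open>C * norm k \<le> \<rho>\<close> for the difference \<open>k\<close> of any two points of
    the ball.\<close>
  define \<delta> where "\<delta> = min \<rho> 1 / (2 * C)"
  have \<delta>: "\<delta> > 0" "C * \<delta> \<le> \<rho> / 2" "C * \<delta> \<le> 1 / 2" using C(1) \<rho>(1) by (auto simp: \<delta>_def)
  have small: "C * norm y \<le> \<rho> / 2" "C * norm y \<le> 1 / 2" if "y \<in> ball 0 \<delta>" for y :: 'c
  proof -
    have "C * norm y \<le> C * \<delta>" using that C(1) by (intro mult_left_mono) auto
    then show "C * norm y \<le> \<rho> / 2" "C * norm y \<le> 1 / 2" using \<delta>(2,3) by linarith+
  qed
  have sub: "x \<in> ?K" if "x \<in> cball x0 \<rho>" for x using that \<rho>(1) by simp
  have "\<exists>z. z 0 = x0 \<and> (\<forall>t\<in>{0..1}. z t \<in> cball x0 \<rho> \<and>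
      (z has_vector_derivative G (z t) y) (at t within {0..1::real}))" if y: "y \<in> ball 0 \<delta>" for y
  proof (rule Picard_unit_interval[where f = "\<lambda>x. G x y"])
    show "norm (G x y) \<le> \<rho>" if "x \<in> cball x0 \<rho>" for x
      using C(2)[OF sub[OF that], of y] small(1)[OF y] \<rho>(1) by linarith
    show "norm (G x y - G x' y) \<le> norm (x - x') / 2" if "x \<in> cball x0 \<rho>" "x' \<in> cball x0 \<rho>" for x x'
    proof -
      have "norm (G x y - G x' y) \<le> (C * norm y) * norm (x - x')"
        using C(4)[OF sub[OF that(1)] sub[OF that(2)], of y] by (simp add: mult_ac)
      also have "\<dots> \<le> 1 / 2 * norm (x - x')" by (intro mult_right_mono small(2)[OF y] norm_ge_zero)
      finally show ?thesis by simp
    qed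
  qed (use \<rho>(1) in auto)
  then obtain z where z: "\<And>y. y \<in> ball 0 \<delta> \<Longrightarrow> z y 0 = x0"
    "\<And>y t. y \<in> ball 0 \<delta> \<Longrightarrow> t \<in> {0..1} \<Longrightarrow> z y t \<in> cball x0 \<rho>"
    "\<And>y t. y \<in> ball 0 \<delta> \<Longrightarrow> t \<in> {0..1} \<Longrightarrow>
      (z y has_vector_derivative G (z y t) y) (at t within {0..1::real})"
    by metis
  define h where "h y = z y 1" for y
  have hU: "h y \<in> U" if "y \<in> ball 0 \<delta>" for y
    using z(2)[OF that, of 1] sub \<rho>(2) by (auto simp: h_def)
  \<comment> \<open>The error is quadratic in \<open>k\<close>, so this already contains the
    differentiability of \<open>h\<close> at \<open>y\<close> with derivative
    \<open>G (h y)\<close>.\<close>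
  have est: "norm (h (y + k) - h y - G (h y) k) \<le> 4 * C\<^sup>2 * (norm k)\<^sup>2"
    if y: "y \<in> ball 0 \<delta>" and yk: "y + k \<in> ball 0 \<delta>" for y k
  proof -
    define q where "q t = z y t + t *\<^sub>R G (z y t) k" for t
    define q' where "q' t = G (z y t) y + (G (z y t) k + t *\<^sub>R ?D k (z y t) (G (z y t) y))" for t
    have k: "C * norm k \<le> \<rho>"
    proof -
      have "norm k \<le> norm (y + k) + norm y" using norm_triangle_ineq4[of "y + k" y] by simp
      then have "C * norm k \<le> C * norm (y + k) + C * norm y"
        using C(1) by (simp add: distrib_left[symmetric])
      then show ?thesis using small(1)[OF y] small(1)[OF yk] by linarith
    qed
    have zU: "z y t \<in> ?K" "z y t \<in> U" if "t \<in> {0..1}" for t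
      using z(2)[OF y that] sub \<rho>(2) by blast+
    have qz: "norm (q t - z y t) \<le> C * norm k" if "t \<in> {0..1}" for t
      using mult_mono[of t 1 "norm (G (z y t) k)" "C * norm k"] C(2)[OF zU(1)[OF that], of k] that C(1)
      by (simp add: q_def)
    have qK: "q t \<in> ?K" if "t \<in> {0..1}" for t
    proof -
      have "dist x0 (q t) \<le> dist x0 (z y t) + norm (q t - z y t)"
        using dist_triangle[of x0 "q t" "z y t"] by (simp add: dist_norm norm_minus_commute)
      then show ?thesis using qz[OF that] k z(2)[OF y that] by simp
    qed
    have dq: "(q has_vector_derivative q' t) (at t within {0..1})" if t: "t \<in> {0..1}" for t
    proof -
      have D: "((\<lambda>x. G x k) has_derivative ?D k (z y t)) (at (z y t))"
        using smooth_on_has_derivative[OF sm zU(2)[OF t]] .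
      have "((\<lambda>t. G (z y t) k) has_vector_derivative ?D k (z y t) (G (z y t) y)) (at t within {0..1})"
        using has_derivative_compose[OF z(3)[OF y t, unfolded has_vector_derivative_def] D]
          linear_cmul[OF has_derivative_linear[OF D]] by (simp add: has_vector_derivative_def)
      from has_vector_derivative_add[OF z(3)[OF y t] has_vector_derivative_scaleR[OF DERIV_ident this]]
      show ?thesis unfolding q_def q'_def by (simp add: add_ac)
    qed
    have "norm (z (y + k) 1 - q 1) \<le> 2 * (2 * C\<^sup>2 * (norm k)\<^sup>2)"
    proof (rule norm_le_of_derivative_le_half)
      fix t :: real assume t: "t \<in> {0..1}"
      show "((\<lambda>t. z (y + k) t - q t) has_vector_derivative G (z (y + k) t) (y + k) - q' t) (at t within {0..1})"
        by (intro has_vector_derivative_diff z(3) dq yk t)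
      let ?z = "z y t" and ?z' = "z (y + k) t"
      have D: "?D (v + w) ?z u = ?D v ?z u + ?D w ?z u" for v w u
      proof -
        have family: "?D a ?z u = (\<Sum>i\<in>Basis. (a \<bullet> i) *\<^sub>R ?D i ?z u)" for a
          by (rule frechet_derivative_linear_family[OF U(1) lin sm zU(2)[OF t]])
        have "(\<Sum>i\<in>Basis. ((v + w) \<bullet> i) *\<^sub>R ?D i ?z u)
            = (\<Sum>i\<in>Basis. (v \<bullet> i) *\<^sub>R ?D i ?z u) + (\<Sum>i\<in>Basis. (w \<bullet> i) *\<^sub>R ?D i ?z u)"
          by (simp only: inner_add_left scaleR_add_left sum.distrib)
        then show ?thesis unfolding family[symmetric] .
      qed
      have lG: "linear (G ?z)" by (rule lin[OF zU(2)[OF t]])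
      have lD: "linear (?D v ?z)" for v
        by (rule has_derivative_linear[OF smooth_on_has_derivative[OF sm zU(2)[OF t]]])
      \<comment> \<open>To first order, \<open>G (q t) (y + k)\<close> differs from
        \<open>G ?z (y + k)\<close> by \<open>t\<close> times the derivatives of the fields of
        \<open>y\<close> and of \<open>k\<close> along \<open>G ?z k\<close>. By \<open>sym\<close>
        the former is the derivative of the field of \<open>k\<close> along \<open>G ?z y\<close>,
        which \<open>q'\<close> contains, so it cancels; the latter is of second order in
        \<open>k\<close>. What remains is a Lipschitz term, absorbed by the factor 1/2, and a Taylor
        remainder.\<close>
      have "G ?z' (y + k) - q' t = (G ?z' (y + k) - G (q t) (y + k))
        + ((G (q t) (y + k) - G ?z (y + k) - ?D (y + k) ?z (q t - ?z)) + t *\<^sub>R ?D k ?z (G ?z k))"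
        using sym[OF zU(2)[OF t], of k y]
        by (simp add: q'_def q_def D linear_add[OF lG] linear_cmul[OF lD] algebra_simps)
      also have "norm \<dots> \<le> norm (?z' - q t) / 2 + (C\<^sup>2 * (norm k)\<^sup>2 + C\<^sup>2 * (norm k)\<^sup>2)"
      proof (intro order_trans[OF norm_triangle_ineq] add_mono)
        have "norm (G ?z' (y + k) - G (q t) (y + k)) \<le> (C * norm (y + k)) * norm (?z' - q t)"
          using C(4)[OF sub[OF z(2)[OF yk t]] qK[OF t], of "y + k"] by (simp add: mult_ac)
        also have "\<dots> \<le> 1 / 2 * norm (?z' - q t)" by (intro mult_right_mono small(2)[OF yk] norm_ge_zero)
        finally show "norm (G ?z' (y + k) - G (q t) (y + k)) \<le> norm (?z' - q t) / 2" by simp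
        have "norm (G (q t) (y + k) - G ?z (y + k) - ?D (y + k) ?z (q t - ?z))
            \<le> (norm (q t - ?z))\<^sup>2 * (C * norm (y + k))"
          using C(5)[OF zU(1)[OF t] qK[OF t], of "y + k"] by (simp add: mult_ac)
        also have "\<dots> \<le> (C * norm k)\<^sup>2 * 1"
          using qz[OF t] small(2)[OF yk] C(1) by (intro mult_mono power_mono) auto
        finally show "norm (G (q t) (y + k) - G ?z (y + k) - ?D (y + k) ?z (q t - ?z)) \<le> C\<^sup>2 * (norm k)\<^sup>2"
          by (simp add: power_mult_distrib)
        have "norm (t *\<^sub>R ?D k ?z (G ?z k)) \<le> C * norm (G ?z k) * norm k"
          using mult_mono[of t 1 "norm (?D k ?z (G ?z k))" "C * norm (G ?z k) * norm k"]
            C(3)[OF zU(1)[OF t], of k "G ?z k"] t C(1) by simp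
        also have "\<dots> \<le> C * (C * norm k) * norm k"
          using C(1) by (intro mult_left_mono mult_right_mono C(2)[OF zU(1)[OF t]]) auto
        finally show "norm (t *\<^sub>R ?D k ?z (G ?z k)) \<le> C\<^sup>2 * (norm k)\<^sup>2"
          by (simp add: power2_eq_square mult_ac)
      qed
      finally show "norm (G ?z' (y + k) - q' t) \<le> norm (?z' - q t) / 2 + 2 * C\<^sup>2 * (norm k)\<^sup>2" by simp
    qed (use z(1) y yk in \<open>simp add: q_def\<close>)
    then show ?thesis by (simp add: h_def q_def algebra_simps)
  qed
  show ?thesis
  proof (intro exI[of _ h] exI[of _ \<delta>] conjI ballI)
    show "\<delta> > 0" by (rule \<delta>(1))
    \<comment> \<open>The ray of \<open>y = 0\<close> has velocity \<open>G (z 0 t) 0 = 0\<close>,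
      so its solution is constant.\<close>
    have "norm (z 0 1 - x0) \<le> 2 * 0"
    proof (rule norm_le_of_derivative_le_half)
      fix t :: real assume t: "t \<in> {0..1}"
      have "z 0 t \<in> U" using z(2)[of 0 t] t \<delta>(1) sub \<rho>(2) by auto
      then have "G (z 0 t) 0 = 0" using linear_0[OF lin] by blast
      then show "((\<lambda>t. z 0 t - x0) has_vector_derivative 0) (at t within {0..1})"
        using z(3)[of 0 t] t \<delta>(1) by (auto intro!: derivative_eq_intros)
    qed (use z(1) \<delta>(1) in auto)
    then show "h 0 = x0" by (simp add: h_def)
    show "h y \<in> U" if "y \<in> ball 0 \<delta>" for y by (rule hU[OF that])
    show "(h has_derivative G (h y)) (at y)" if y: "y \<in> ball 0 \<delta>" for y
      unfolding has_derivative_at_alt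
    proof (intro conjI allI impI)
      show "bounded_linear (G (h y))"
        using lin[OF hU[OF y]] by (simp add: linear_conv_bounded_linear)
      fix e :: real assume "e > 0"
      \<comment> \<open>The first bound keeps \<open>y'\<close> in the ball where \<open>est\<close>
        applies, the second turns its quadratic error into \<open>e * norm (y' - y)\<close>.\<close>
      define d where "d = min (\<delta> - norm y) (e / (4 * C\<^sup>2))"
      have "d > 0" using y \<open>e > 0\<close> C(1) by (simp add: d_def)
      moreover have "norm (h y' - h y - G (h y) (y' - y)) \<le> e * norm (y' - y)" if d: "norm (y' - y) < d" for y'
      proof -
        have "norm y' \<le> norm y + norm (y' - y)" using norm_triangle_ineq[of y "y' - y"] by simp
        then have "y + (y' - y) \<in> ball 0 \<delta>" using d by (simp add: d_def)
        from est[OF y this] have "norm (h y' - h y - G (h y) (y' - y)) \<le> (4 * C\<^sup>2 * norm (y' - y)) * norm (y' - y)"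
          by (simp add: power2_eq_square mult_ac)
        also have "\<dots> \<le> e * norm (y' - y)"
          using d C(1) by (intro mult_right_mono) (auto simp: d_def field_simps)
        finally show ?thesis .
      qed
      ultimately show "\<exists>d>0. \<forall>y'. norm (y' - y) < d \<longrightarrow>
          norm (h y' - h y - G (h y) (y' - y)) \<le> e * norm (y' - y)" by blast
    qed
  qed
qed

text \<open>Bootstrapping: if \<open>h\<close> is of order \<open>k\<close>, so is the right-hand
  side \<open>G (h y) v\<close>, which is the derivative of \<open>h\<close>, and \<open>h\<close>
  gains one order.\<close>

lemma total_differential_equation_smooth:
  fixes G :: "'a::euclidean_space \<Rightarrow> 'c::euclidean_space \<Rightarrow> 'a"
  assumes sm: "\<And>v. smooth_on (\<lambda>x. G x v) U" and S: "open S" and h: "\<And>y. y \<in> S \<Longrightarrow> h y \<in> U"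
    "\<And>y. y \<in> S \<Longrightarrow> (h has_derivative G (h y)) (at y)"
  shows "smooth_on h S"
proof -
  have "Ck_on k h S" for k
  proof (induction k)
    case 0
    have "continuous (at y) h" if "y \<in> S" for y using h(2)[OF that] by (rule has_derivative_continuous)
    then show ?case by (simp add: continuous_at_imp_continuous_on)
  next
    case (Suc k)
    have G: "Ck_on k (\<lambda>x. G x v) U" for v using sm by (simp add: smooth_on_def)
    have "Ck_on k (\<lambda>y. G (h y) v) S" for v
      using h(1) by (intro Ck_on_compose[OF S G Suc.IH]) auto
    from Ck_on_SucI[OF S h(2) this] show ?case .
  qed
  then show ?thesis by (simp add: smooth_on_def)
qed

section \<open>Straightening a leaf\<close>

text \<open>Pairing with \<open>u\<close> orthogonal to \<open>V\<close> gives a function that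
  vanishes near 0 on the line, hence has derivative 0, and \<open>V\<close> is its own double
  orthogonal complement. Only one line is involved, so the lemma applies along a slice even when
  \<open>f\<close> leaves \<open>V\<close> elsewhere.\<close>

lemma has_derivative_in_subspace:
  fixes f :: "'a::real_normed_vector \<Rightarrow> 'b::euclidean_space"
  assumes f: "(f has_derivative f') (at x)" and V: "subspace V"
    and ev: "\<forall>\<^sub>F t in at 0. f (x + t *\<^sub>R v) \<in> V" and "f x \<in> V"
  shows "f' v \<in> V"
proof -
  have "((\<lambda>t. f (x + t *\<^sub>R v)) has_derivative (\<lambda>t. f' (t *\<^sub>R v))) (at 0)"
    by (rule has_derivative_compose[where f = "\<lambda>t. x + t *\<^sub>R v" and g = f])
      (use f in \<open>auto intro!: derivative_eq_intros\<close>)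
  then have d: "((\<lambda>t. f (x + t *\<^sub>R v)) has_vector_derivative f' v) (at 0)"
    using linear_cmul[OF has_derivative_linear[OF f]] by (simp add: has_vector_derivative_def)
  have "(f' v) \<bullet> u = 0" if u: "u \<in> V\<^sup>\<bottom>" for u
  proof -
    have z: "w \<bullet> u = 0" if "w \<in> V" for w
      using u that by (auto simp: orthogonal_comp_def orthogonal_def inner_commute)
    have "((\<lambda>t. f (x + t *\<^sub>R v) \<bullet> u) has_vector_derivative f' v \<bullet> u) (at 0)"
      by (rule bounded_linear.has_vector_derivative[OF bounded_linear_inner_left d])
    moreover have "((\<lambda>t. f (x + t *\<^sub>R v) \<bullet> u) has_vector_derivative 0) (at 0)"
    proof -
      obtain e where e: "e > 0" "\<And>t. t \<noteq> 0 \<Longrightarrow> dist t 0 < e \<Longrightarrow> f (x + t *\<^sub>R v) \<in> V"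
        using ev unfolding eventually_at by blast
      have "f (x + t *\<^sub>R v) \<bullet> u = 0" if "t \<in> ball 0 e" for t
        using z e(2)[of t] that \<open>f x \<in> V\<close> by (cases "t = 0") (auto simp: dist_commute)
      then have eq: "0 = f (x + t *\<^sub>R v) \<bullet> u" if "t \<in> ball 0 e" for t using that by simp
      have "((\<lambda>t::real. 0::real) has_vector_derivative 0) (at 0)" by (rule has_vector_derivative_const)
      then show ?thesis
        by (rule has_vector_derivative_transform_within_open[OF _ open_ball[of 0 e] _ eq]) (use e(1) in auto)
    qed
    ultimately show ?thesis by (rule vector_derivative_unique_at)
  qed
  then have "u \<bullet> f' v = 0" if "u \<in> V\<^sup>\<bottom>" for u using that inner_commute[of u "f' v"] by simp
  then have "f' v \<in> V\<^sup>\<bottom>\<^sup>\<bottom>"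
    unfolding orthogonal_comp_def[of "V\<^sup>\<bottom>"] orthogonal_def mem_Collect_eq by (rule ballI)
  then show ?thesis using V by (simp add: orthogonal_comp_self)
qed

text \<open>Brackets of the fields \<open>x \<mapsto> G x v\<close> lie both in the range of \<open>A x\<close> and in the kernel of \<open>P\<close>,
  so they vanish.\<close>

lemma commuting_frame:
  fixes A :: "real^'n::finite \<Rightarrow> real^'n^'n"
  assumes U: "open U" "x0 \<in> U" and A: "smooth_on A U" and rk: "\<And>x. x \<in> U \<Longrightarrow> rank (A x) = r"
    and inv: "\<And>W a b x. open W \<Longrightarrow> W \<subseteq> U \<Longrightarrow> x \<in> W \<Longrightarrow> smooth_on a W \<Longrightarrow> smooth_on b W \<Longrightarrow>
      frechet_derivative (\<lambda>x. A x *v b x) (at x) (A x *v a x)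
      - frechet_derivative (\<lambda>x. A x *v a x) (at x) (A x *v b x) \<in> range ((*v) (A x))"
  obtains P G V W where "linear P" "subspace V" "\<And>v. P v \<in> V" "\<And>v. v \<in> V \<Longrightarrow> P v = v"
    "open W" "x0 \<in> W" "W \<subseteq> U" "\<And>x. x \<in> W \<Longrightarrow> linear (G x)" "\<And>v. smooth_on (\<lambda>x. G x v) W"
    "\<And>x v. x \<in> W \<Longrightarrow> P (G x v) = P v" "\<And>x v. G x v = G x (P v)"
    "\<And>x. x \<in> W \<Longrightarrow> range ((*v) (A x)) = G x ` V"
    "\<And>x v w. x \<in> W \<Longrightarrow> frechet_derivative (\<lambda>x. G x w) (at x) (G x v)
      = frechet_derivative (\<lambda>x. G x v) (at x) (G x w)"
proof -
  define V where "V = range ((*v) (A x0))"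
  have V: "subspace V" unfolding V_def by (intro linear_subspace_image) auto
  obtain P where P: "linear P" "\<And>v. P v \<in> V" "\<And>v. v \<in> V \<Longrightarrow> P v = v"
    using linear_exists_left_inverse_on[OF linear_id V] by (auto simp: image_subset_iff)
  have PP: "P (P v) = P v" for v using P(2,3) by blast
  obtain g where g: "linear g" "\<And>v. v \<in> V \<Longrightarrow> A x0 *v g v = v"
    using linear_exists_right_inverse_on[OF matrix_vector_mul_linear subspace_UNIV, of "A x0"]
    unfolding V_def by auto
  \<comment> \<open>With respect to the splitting into \<open>V\<close> and the kernel of
    \<open>P\<close>, this is the \<open>V\<close>-component of \<open>A x\<close> after the section
    \<open>g\<close> on \<open>V\<close>, and the identity on the kernel. It is the identity at
    \<open>x0\<close>, hence invertible nearby.\<close>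
  define M where "M x = matrix (\<lambda>v. P (A x *v g (P v)) + (v - P v))" for x
  have lin: "linear (\<lambda>v. P (A x *v g (P v)) + (v - P v))" for x
    using P(1) g(1)
    by (auto intro!: linearI simp: linear_add linear_cmul matrix_vector_right_distrib
        matrix_vector_mult_scaleR scaleR_diff_right algebra_simps)
  have M: "M x *v v = P (A x *v g (P v)) + (v - P v)" for x v
    unfolding M_def by (simp add: matrix_works[OF linear_matrix_vector_mul_eq[THEN iffD2, OF lin]])
  have bP: "bounded_linear P" using P(1) by (simp add: linear_conv_bounded_linear)
  have bg: "bounded_linear g" using g(1) by (simp add: linear_conv_bounded_linear)
  have smM: "smooth_on M U"
    unfolding smooth_on_matrix_iff[OF U(1)] M
    by (intro allI smooth_on_add[OF U(1)] smooth_on_bounded_linear_compose[OF U(1) bP]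
        smooth_on_matrix_vector_mult[OF U(1) A] smooth_on_const[OF U(1)])
  define W where "W = {x \<in> U. det (M x) \<noteq> 0}"
  have "continuous_on U (\<lambda>x. det (M x))"
    using smooth_on_continuous_on[OF smM] unfolding det_def
    by (intro continuous_intros) auto
  then have "open (U \<inter> (\<lambda>x. det (M x)) -` (- {0}))"
    by (rule continuous_open_preimage[OF _ U(1)]) auto
  moreover have "W = U \<inter> (\<lambda>x. det (M x)) -` (- {0})" by (auto simp: W_def)
  ultimately have W: "open W" by simp
  have WU: "W \<subseteq> U" by (auto simp: W_def)
  have "M x0 = mat 1"
    using g(2) P(2,3) by (intro matrix_eq[THEN iffD2]) (auto simp: M)
  then have x0: "x0 \<in> W" using U(2) by (simp add: W_def)
  \<comment> \<open>Inverting \<open>M x\<close> on \<open>V\<close> normalises the frame. Writing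
    the frame as \<open>A x\<close> applied to the smooth coefficients \<open>a v x\<close> brings
    its brackets under \<open>inv\<close>.\<close>
  define a where "a v x = g (P (matrix_inv (M x) *v P v))" for v x
  define G where "G x v = A x *v a v x" for x v
  have sma: "smooth_on (a v) W" for v
  proof -
    have "smooth_on (\<lambda>x. matrix_inv (M x)) W"
      by (rule smooth_on_matrix_inv[OF W smooth_on_subset[OF smM WU]])
        (auto simp: W_def invertible_det_nz)
    then show ?thesis unfolding a_def
      by (rule smooth_on_bounded_linear_compose[OF W bg smooth_on_bounded_linear_compose[OF W bP
            smooth_on_matrix_vector_mult[OF W _ smooth_on_const[OF W]]]])
  qed
  have smG: "smooth_on (\<lambda>x. G x v) W" for v
    unfolding G_def by (rule smooth_on_matrix_vector_mult[OF W smooth_on_subset[OF A WU] sma])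
  have linG: "linear (G x)" for x
    unfolding G_def a_def using P(1) g(1)
    by (auto intro!: linearI simp: linear_add linear_cmul matrix_vector_right_distrib
        matrix_vector_mult_scaleR)
  have PG: "P (G x v) = P v" if "x \<in> W" for x v
  proof -
    define u where "u = matrix_inv (M x) *v P v"
    have "invertible (M x)" using that by (simp add: W_def invertible_det_nz)
    then have "M x *v u = P v" unfolding u_def by (simp add: matrix_vector_mul_assoc matrix_inv_right)
    then have Mu: "P (A x *v g (P u)) + (u - P u) = P v" by (simp add: M)
    \<comment> \<open>The right-hand side lies in \<open>V\<close>, so \<open>u - P u\<close> lies
      in \<open>V\<close> and in the kernel of \<open>P\<close> and must vanish.\<close>
    then have "u - P u = P v - P (A x *v g (P u))" by (simp add: algebra_simps)
    then have "P (u - P u) = u - P u" using P(2,3) V by (metis subspace_diff)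
    then have "u = P u" using PP linear_diff[OF P(1)] by simp
    then show ?thesis using Mu by (simp add: G_def a_def u_def)
  qed
  have rangeG: "range ((*v) (A x)) = G x ` V" if x: "x \<in> W" for x
  proof -
    \<comment> \<open>\<open>P\<close> is a left inverse of \<open>G x\<close> on \<open>V\<close>;
      the constant rank then upgrades the inclusion of images to an equality by dimension.\<close>
    have "inj_on (G x) V" using PG[OF x] P(3) by (intro inj_onI) metis
    then have "dim (G x ` V) = dim V"
      using linG[of x] V by (intro dim_image_eq) (auto simp: span_eq_iff[THEN iffD2])
    also have "\<dots> = rank (A x0)" unfolding V_def by (simp add: rank_dim_range)
    also have "\<dots> = rank (A x)" using rk U(2) x WU by auto
    also have "\<dots> = dim (range ((*v) (A x)))" by (simp add: rank_dim_range)
    finally have dim: "dim (G x ` V) = dim (range ((*v) (A x)))" .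
    have "G x ` V = range ((*v) (A x))"
    proof (rule subspace_dim_equal)
      show "subspace (range ((*v) (A x)))"
        by (rule linear_subspace_image[OF matrix_vector_mul_linear subspace_UNIV])
      show "G x ` V \<subseteq> range ((*v) (A x))" by (auto simp: G_def)
    qed (use dim linear_subspace_image[OF linG V] in auto)
    then show ?thesis by simp
  qed
  show ?thesis
  proof (rule that[of P V W G])
    show "G x v = G x (P v)" for x v by (simp add: G_def a_def PP)
    show "frechet_derivative (\<lambda>x. G x w) (at x) (G x v) = frechet_derivative (\<lambda>x. G x v) (at x) (G x w)"
      if x: "x \<in> W" for x v w
    proof -
      have P0: "P (frechet_derivative (\<lambda>x. G x w) (at x) u) = 0" for w u
      proof -
        have "((\<lambda>x. P (G x w)) has_derivative (\<lambda>u. P (frechet_derivative (\<lambda>x. G x w) (at x) u))) (at x)"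
          by (rule bounded_linear.has_derivative[OF bP smooth_on_has_derivative[OF smG x]])
        moreover have "((\<lambda>x. P (G x w)) has_derivative (\<lambda>u. 0)) (at x)"
          by (rule has_derivative_transform_within_open[OF has_derivative_const[of "P w"] W x])
            (simp add: PG)
        ultimately show ?thesis by (metis has_derivative_unique)
      qed
      let ?B = "frechet_derivative (\<lambda>x. G x w) (at x) (G x v) - frechet_derivative (\<lambda>x. G x v) (at x) (G x w)"
      have "?B \<in> range ((*v) (A x))"
        unfolding G_def by (rule inv[OF W WU x sma sma])
      then obtain u where u: "u \<in> V" "?B = G x u" using rangeG[OF x] by auto
      have "P ?B = 0" using P0 linear_diff[OF P(1)] by simp
      then have "u = 0" using u PG[OF x] P(3) by simp
      then show ?thesis using u(2) linear_0[OF linG] by simp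
    qed
  qed (use P V W x0 WU linG smG PG rangeG in auto)
qed

text \<open>With \<open>h\<close> the leaf through \<open>x0\<close>, parametrised so that \<open>P (h y) = P x0 + P y\<close>, the map
  \<open>y \<mapsto> h (P y) + y - P y\<close> is a shear with the explicit inverse
  \<open>x \<mapsto> x - h (P (x - x0)) + P (x - x0)\<close>.\<close>

lemma straighten_leaf:
  fixes A :: "real^'n::finite \<Rightarrow> real^'n^'n"
  assumes U: "open U" "x0 \<in> U" and A: "smooth_on A U" and rk: "\<And>x. x \<in> U \<Longrightarrow> rank (A x) = r"
    and inv: "\<And>W a b x. open W \<Longrightarrow> W \<subseteq> U \<Longrightarrow> x \<in> W \<Longrightarrow> smooth_on a W \<Longrightarrow> smooth_on b W \<Longrightarrow>
      frechet_derivative (\<lambda>x. A x *v b x) (at x) (A x *v a x)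
      - frechet_derivative (\<lambda>x. A x *v a x) (at x) (A x *v b x) \<in> range ((*v) (A x))"
  obtains \<Phi> \<Psi> :: "real^'n \<Rightarrow> real^'n" and V N where "subspace V" "open N" "x0 \<in> N" "N \<subseteq> U"
    "open (\<Psi> ` N)" "smooth_on \<Psi> N" "smooth_on \<Phi> (\<Psi> ` N)" "\<And>x. x \<in> N \<Longrightarrow> \<Phi> (\<Psi> x) = x" "\<Psi> x0 \<in> V"
    "\<And>x. x \<in> N \<Longrightarrow> \<Psi> x \<in> V \<Longrightarrow> range ((*v) (A x)) = frechet_derivative \<Phi> (at (\<Psi> x)) ` V"
proof (rule commuting_frame[OF assms])
  fix P G V W
  assume P: "linear P" "subspace V" "\<And>v. P v \<in> V" "\<And>v. v \<in> V \<Longrightarrow> P v = v"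
    and W: "open W" "x0 \<in> W" "W \<subseteq> U" and linG: "\<And>x. x \<in> W \<Longrightarrow> linear (G x)"
    and smG: "\<And>v. smooth_on (\<lambda>x. G x v) W"
    and PG: "\<And>x v. x \<in> W \<Longrightarrow> P (G x v) = P v" and GP: "\<And>x v. G x v = G x (P v)"
    and rangeG: "\<And>x. x \<in> W \<Longrightarrow> range ((*v) (A x)) = G x ` V"
    and commute: "\<And>x v w. x \<in> W \<Longrightarrow> frechet_derivative (\<lambda>x. G x w) (at x) (G x v)
      = frechet_derivative (\<lambda>x. G x v) (at x) (G x w)"
  have PP: "P (P v) = P v" for v using P(3,4) by blast
  have bP: "bounded_linear P" using P(1) by (simp add: linear_conv_bounded_linear)
  have Padd: "P (v + w) = P v + P w" "P (v - w) = P v - P w" for v w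
    using P(1) by (auto simp: linear_add linear_diff)
  have "\<exists>h \<delta>. \<delta> > 0 \<and> h 0 = x0 \<and> (\<forall>y\<in>ball 0 \<delta>. h y \<in> W \<and> (h has_derivative G (h y)) (at y))"
    by (rule total_differential_equation[OF W(1,2) linG smG commute])
  then obtain h \<delta> where \<delta>: "\<delta> > 0" and h0: "h 0 = x0"
    and h: "\<forall>y\<in>ball 0 \<delta>. h y \<in> W \<and> (h has_derivative G (h y)) (at y)" by blast
  have hW: "\<And>y. y \<in> ball 0 \<delta> \<Longrightarrow> h y \<in> W"
    and dh: "\<And>y. y \<in> ball 0 \<delta> \<Longrightarrow> (h has_derivative G (h y)) (at y)"
    using h by blast+
  have smh: "smooth_on h (ball 0 \<delta>)"
    by (rule total_differential_equation_smooth[OF smG open_ball hW dh])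
  \<comment> \<open>The difference \<open>P (h y) - P y\<close> has derivative
    \<open>P (G (h y) v) - P v = 0\<close>: the leaf is a graph over \<open>V\<close>, which is why
    the shear has an explicit inverse.\<close>
  have Ph: "P (h y) = P x0 + P y" if y: "y \<in> ball 0 \<delta>" for y
  proof -
    have "((\<lambda>y. P (h y) - P y) has_derivative (\<lambda>_. 0)) (at y within ball 0 \<delta>)" if "y \<in> ball 0 \<delta>" for y
    proof (rule has_derivative_at_withinI)
      have "((\<lambda>y. P (h y) - P y) has_derivative (\<lambda>v. P (G (h y) v) - P v)) (at y)"
        by (intro has_derivative_diff bounded_linear.has_derivative[OF bP] dh that has_derivative_ident)
      then show "((\<lambda>y. P (h y) - P y) has_derivative (\<lambda>_. 0)) (at y)"
        using PG[OF hW[OF that]] by simp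
    qed
    from has_derivative_zero_constant[OF convex_ball this]
    obtain c where c: "\<And>y. y \<in> ball 0 \<delta> \<Longrightarrow> P (h y) - P y = c" by blast
    have "P (h y) - P y = P (h 0) - P 0" using c[OF y] c[of 0] \<delta> by simp
    then show ?thesis using h0 linear_0[OF P(1)] by (simp add: algebra_simps)
  qed
  define \<Phi> where "\<Phi> y = h (P y) + (y - P y)" for y
  define \<Psi> where "\<Psi> x = x - h (P (x - x0)) + P (x - x0)" for x
  define N where "N = U \<inter> (\<lambda>x. P (x - x0)) -` ball 0 \<delta>"
  define B where "B = P -` ball 0 \<delta>"
  have contP: "continuous_on S P" for S by (rule linear_continuous_on[OF bP])
  have contPx: "continuous_on S (\<lambda>x. P (x - x0))" for S
    by (rule continuous_on_compose2[OF contP[of UNIV]]) (auto intro: continuous_intros)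
  have B: "open B" unfolding B_def by (intro open_vimage open_ball contP)
  have N: "open N" unfolding N_def by (intro open_Int U(1) open_vimage open_ball contPx)
  have sm\<Phi>: "smooth_on \<Phi> B"
    unfolding \<Phi>_def
    by (intro smooth_on_add[OF B] smooth_on_diff[OF B] smooth_on_ident[OF B]
        smooth_on_bounded_linear[OF B bP] smooth_on_compose[OF B smh]) (auto simp: B_def)
  have smP: "smooth_on (\<lambda>x. P (x - x0)) N"
    by (rule smooth_on_bounded_linear_compose[OF N bP
          smooth_on_diff[OF N smooth_on_ident[OF N] smooth_on_const[OF N]]])
  have sm\<Psi>: "smooth_on \<Psi> N"
    unfolding \<Psi>_def
    by (intro smooth_on_add[OF N] smooth_on_diff[OF N] smooth_on_ident[OF N]
        smooth_on_compose[OF N smh] smP) (auto simp: N_def)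
  have P\<Psi>: "P (\<Psi> x) = P (x - x0)" if "x \<in> N" for x
    using Ph[of "P (x - x0)"] that by (simp add: \<Psi>_def N_def Padd PP)
  have \<Phi>\<Psi>: "\<Phi> (\<Psi> x) = x" if "x \<in> N" for x
    unfolding \<Phi>_def P\<Psi>[OF that] by (simp add: \<Psi>_def)
  have P\<Phi>: "P (\<Phi> y - x0) = P y" if "y \<in> B" for y
    using Ph[of "P y"] that by (simp add: \<Phi>_def B_def Padd PP)
  have \<Psi>\<Phi>: "\<Psi> (\<Phi> y) = y" if "y \<in> B" for y
    unfolding \<Psi>_def P\<Phi>[OF that] by (simp add: \<Phi>_def)
  \<comment> \<open>In this form the image of \<open>N\<close> is seen to be open from the
    continuity of \<open>\<Phi>\<close>.\<close>
  have \<Psi>N: "\<Psi> ` N = B \<inter> \<Phi> -` U"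
  proof (intro equalityI subsetI)
    fix y assume "y \<in> \<Psi> ` N"
    then obtain x where "x \<in> N" "y = \<Psi> x" by blast
    then show "y \<in> B \<inter> \<Phi> -` U" using P\<Psi> \<Phi>\<Psi> by (auto simp: B_def N_def)
  next
    fix y assume y: "y \<in> B \<inter> \<Phi> -` U"
    then have "\<Phi> y \<in> N" using P\<Phi>[of y] by (auto simp: N_def B_def)
    then show "y \<in> \<Psi> ` N" using \<Psi>\<Phi>[of y] y by (metis IntD1 imageI)
  qed
  show thesis
  proof (rule that[of V N \<Psi> \<Phi>])
    show "x0 \<in> N" using U(2) \<delta> linear_0[OF P(1)] by (simp add: N_def)
    show "\<Psi> x0 \<in> V" using h0 linear_0[OF P(1)] P(2) by (simp add: \<Psi>_def subspace_0)
    show "open (\<Psi> ` N)"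
      unfolding \<Psi>N by (rule continuous_open_preimage[OF smooth_on_continuous_on[OF sm\<Phi>] B U(1)])
    show "smooth_on \<Phi> (\<Psi> ` N)" unfolding \<Psi>N by (rule smooth_on_subset[OF sm\<Phi>]) auto
    show "range ((*v) (A x)) = frechet_derivative \<Phi> (at (\<Psi> x)) ` V" if x: "x \<in> N" "\<Psi> x \<in> V" for x
    proof -
      \<comment> \<open>If \<open>y = \<Psi> x\<close> lies in \<open>V\<close>, then
        \<open>P y = y\<close> and \<open>x = h y\<close> is on the leaf. There the derivative of
        \<open>\<Phi>\<close> restricts to \<open>G x\<close> on \<open>V\<close>, because
        \<open>v - P v\<close> vanishes for \<open>v\<close> in \<open>V\<close>.\<close>
      define y where "y = \<Psi> x"
      have y: "y \<in> B" "P y = y" using x \<Psi>N P(4) unfolding y_def by blast+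
      then have yb: "y \<in> ball 0 \<delta>" by (simp add: B_def)
      have "h y = x" using \<Phi>\<Psi>[OF x(1)] y(2) by (simp add: \<Phi>_def y_def)
      then have xW: "x \<in> W" and dhx: "(h has_derivative G x) (at (P y))"
        using hW[OF yb] dh[OF yb] y(2) by auto
      have "(\<Phi> has_derivative (\<lambda>v. G x (P v) + (v - P v))) (at y)"
        unfolding \<Phi>_def
        by (intro has_derivative_add has_derivative_diff has_derivative_ident
            bounded_linear_imp_has_derivative[OF bP]
            has_derivative_compose[OF bounded_linear_imp_has_derivative[OF bP] dhx])
      from frechet_derivative_at[OF this, symmetric]
      have "frechet_derivative \<Phi> (at y) ` V = G x ` V" using P(4) by (auto simp: image_iff)
      then show ?thesis using rangeG[OF xW] by (simp add: y_def)
    qed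
  qed (use P(2) N sm\<Psi> \<Phi>\<Psi> in \<open>auto simp: N_def\<close>)
qed

section \<open>Manifolds and Lie brackets\<close>

lemma is_chartD:
  assumes "is_chart c"
  shows "open (fst c)" "open (snd c ` fst c)" "inj_on (snd c) (fst c)"
    "continuous_on (fst c) (snd c)" "continuous_on (snd c ` fst c) (chart_inv c)"
proof -
  obtain \<psi> where \<psi>: "homeomorphism (fst c) (snd c ` fst c) (snd c) \<psi>"
    using assms by (auto simp: is_chart_def)
  then have inv: "\<psi> (snd c p) = p" if "p \<in> fst c" for p
    using that by (simp add: homeomorphism_def)
  show "open (fst c)" "open (snd c ` fst c)" using assms by (auto simp: is_chart_def)
  show inj: "inj_on (snd c) (fst c)" using inv by (rule inj_on_inverseI)
  show "continuous_on (fst c) (snd c)" using \<psi> by (simp add: homeomorphism_def)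
  have "continuous_on (snd c ` fst c) \<psi>" using \<psi> by (simp add: homeomorphism_def)
  then show "continuous_on (snd c ` fst c) (chart_inv c)"
    by (rule continuous_on_eq) (auto simp: inv inj chart_inv_def)
qed

lemma chart_inv_left: "is_chart c \<Longrightarrow> p \<in> fst c \<Longrightarrow> chart_inv c (snd c p) = p"
  by (simp add: chart_inv_def is_chartD(3))

lemma chart_inv_right:
  "x \<in> snd c ` fst c \<Longrightarrow> snd c (chart_inv c x) = x"
  "x \<in> snd c ` fst c \<Longrightarrow> chart_inv c x \<in> fst c"
  by (auto simp: chart_inv_def f_inv_into_f inv_into_into)

lemma chart_open_image:
  assumes "is_chart c" "open W" "W \<subseteq> fst c"
  shows "open (snd c ` W)"
proof -
  have "open (snd c ` fst c \<inter> chart_inv c -` W)"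
    by (rule continuous_open_preimage[OF is_chartD(5,2)[OF assms(1)] assms(2)])
  moreover have "snd c ` fst c \<inter> chart_inv c -` W = snd c ` W"
    using assms(3) chart_inv_left[OF assms(1)] by (auto simp: subset_iff image_iff)
  ultimately show ?thesis by simp
qed

lemma chart_open_preimage:
  assumes "is_chart c" "open N"
  shows "open (fst c \<inter> snd c -` N)"
  by (rule continuous_open_preimage[OF is_chartD(4,1)[OF assms(1)] assms(2)])

lemma transition_chart: "is_chart c \<Longrightarrow> p \<in> fst c \<Longrightarrow> transition c d (snd c p) = snd d p"
  by (simp add: transition_def chart_inv_left)

section \<open>Naturality of the Lie bracket under smooth maps\<close>

lemma frechet_derivative_along_field:
  fixes \<tau> :: "'a::euclidean_space \<Rightarrow> 'b::real_normed_vector" and X :: "'a \<Rightarrow> 'a"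
  assumes S: "open S" "smooth_on \<tau> S" "x \<in> S" and X: "(X has_derivative X') (at x)"
  shows "((\<lambda>y. frechet_derivative \<tau> (at y) (X y)) has_derivative
    (\<lambda>w. frechet_derivative (\<lambda>y. frechet_derivative \<tau> (at y) (X x)) (at x) w
      + frechet_derivative \<tau> (at x) (X' w))) (at x)"
proof -
  let ?D = "\<lambda>i y. frechet_derivative \<tau> (at y) i"
  have eucl: "?D v y = (\<Sum>i\<in>Basis. (v \<bullet> i) *\<^sub>R ?D i y)" if "y \<in> S" for v y
    by (rule frechet_derivative_euclidean[OF smooth_on_differentiable[OF S(2) that]])
  have D: "(?D i has_derivative frechet_derivative (?D i) (at x)) (at x)" for i
    by (rule smooth_on_has_derivative[OF smooth_on_frechet_derivative[OF S(2)] S(3)])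
  \<comment> \<open>Base point and direction both vary with \<open>y\<close>; in a basis this
    becomes the ordinary product rule.\<close>
  have "((\<lambda>y. \<Sum>i\<in>Basis. (X y \<bullet> i) *\<^sub>R ?D i y) has_derivative
      (\<lambda>w. \<Sum>i\<in>Basis. (X x \<bullet> i) *\<^sub>R frechet_derivative (?D i) (at x) w + (X' w \<bullet> i) *\<^sub>R ?D i x)) (at x)"
    by (intro has_derivative_sum has_derivative_scaleR D has_derivative_inner_left X)
  then have "((\<lambda>y. ?D (X y) y) has_derivative
      (\<lambda>w. \<Sum>i\<in>Basis. (X x \<bullet> i) *\<^sub>R frechet_derivative (?D i) (at x) w + (X' w \<bullet> i) *\<^sub>R ?D i x)) (at x)"
    by (rule has_derivative_transform_within_open[OF _ S(1,3)]) (simp add: eucl[symmetric])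
  moreover have "frechet_derivative (?D (X x)) (at x) w
      = (\<Sum>i\<in>Basis. (X x \<bullet> i) *\<^sub>R frechet_derivative (?D i) (at x) w)" for w
    by (rule frechet_derivative_linear_family[of S "\<lambda>y v. ?D v y"])
      (use S linear_frechet_derivative smooth_on_differentiable smooth_on_frechet_derivative in blast)+
  ultimately show ?thesis by (simp add: sum.distrib eucl[OF S(3), symmetric])
qed

lemma smooth_on_along_field:
  fixes \<tau> :: "'a::euclidean_space \<Rightarrow> 'b::real_normed_vector" and X :: "'a \<Rightarrow> 'a"
  assumes S: "open S" "smooth_on \<tau> S" and X: "smooth_on X S"
  shows "smooth_on (\<lambda>y. frechet_derivative \<tau> (at y) (X y)) S"
proof (rule smooth_on_cong[OF _ S(1)])
  show "smooth_on (\<lambda>y. \<Sum>i\<in>Basis. (X y \<bullet> i) *\<^sub>R frechet_derivative \<tau> (at y) i) S"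
    by (intro smooth_on_sum[OF S(1)] smooth_on_scaleR[OF S(1)] smooth_on_frechet_derivative[OF S(2)]
        smooth_on_bounded_linear_compose[OF S(1) bounded_linear_inner_left X])
qed (simp add: frechet_derivative_euclidean[OF smooth_on_differentiable[OF S(2)], symmetric])

text \<open>Differentiating the two relations gives, besides the pushed-forward derivatives, one
  second derivative of \<open>\<tau>\<close> in the directions \<open>X x\<close> and
  \<open>Y x\<close> each; these agree by symmetry and cancel in the difference.\<close>

lemma bracket_pushforward:
  fixes \<tau> :: "'a::euclidean_space \<Rightarrow> 'b::real_normed_vector" and X Y :: "'a \<Rightarrow> 'a"
  assumes S: "open S" "smooth_on \<tau> S" "x \<in> S"
    and X: "X differentiable (at x)" and Y: "Y differentiable (at x)"
    and X': "X' differentiable (at (\<tau> x))" and Y': "Y' differentiable (at (\<tau> x))"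
    and rel: "\<And>y. y \<in> S \<Longrightarrow> X' (\<tau> y) = frechet_derivative \<tau> (at y) (X y)"
      "\<And>y. y \<in> S \<Longrightarrow> Y' (\<tau> y) = frechet_derivative \<tau> (at y) (Y y)"
  shows "frechet_derivative Y' (at (\<tau> x)) (X' (\<tau> x)) - frechet_derivative X' (at (\<tau> x)) (Y' (\<tau> x))
    = frechet_derivative \<tau> (at x) (frechet_derivative Y (at x) (X x) - frechet_derivative X (at x) (Y x))"
proof -
  have \<tau>: "(\<tau> has_derivative frechet_derivative \<tau> (at x)) (at x)"
    by (rule smooth_on_has_derivative[OF S(2,3)])
  have chain: "frechet_derivative Z' (at (\<tau> x)) (frechet_derivative \<tau> (at x) w)
      = frechet_derivative (\<lambda>y. frechet_derivative \<tau> (at y) (Z x)) (at x) w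
        + frechet_derivative \<tau> (at x) (frechet_derivative Z (at x) w)"
    if Z: "Z differentiable (at x)" "Z' differentiable (at (\<tau> x))"
      and eq: "\<And>y. y \<in> S \<Longrightarrow> Z' (\<tau> y) = frechet_derivative \<tau> (at y) (Z y)"
    for Z :: "'a \<Rightarrow> 'a" and Z' w
  proof -
    have "((\<lambda>y. Z' (\<tau> y)) has_derivative
        (\<lambda>w. frechet_derivative Z' (at (\<tau> x)) (frechet_derivative \<tau> (at x) w))) (at x)"
      by (rule has_derivative_compose[OF \<tau> frechet_derivative_works[THEN iffD1, OF Z(2)]])
    then have 1: "((\<lambda>y. frechet_derivative \<tau> (at y) (Z y)) has_derivative
        (\<lambda>w. frechet_derivative Z' (at (\<tau> x)) (frechet_derivative \<tau> (at x) w))) (at x)"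
      by (rule has_derivative_transform_within_open[OF _ S(1,3)]) (rule eq)
    from has_derivative_unique[OF 1 frechet_derivative_along_field[OF S
        frechet_derivative_works[THEN iffD1, OF Z(1)]]]
    show ?thesis by (rule fun_cong)
  qed
  show ?thesis
    using chain[OF Y Y' rel(2), of "X x"] chain[OF X X' rel(1), of "Y x"]
      second_derivative_symmetric[OF S, of "X x" "Y x"] rel[OF S(3)]
      linear_diff[OF has_derivative_linear[OF \<tau>]]
    by simp
qed

locale smooth_manifold =
  fixes A :: "('a::{t2_space, second_countable_topology}, 'n::finite) chart set"
  assumes smooth_structure: "smooth_structure A"
begin

lemma chart: "c \<in> A \<Longrightarrow> is_chart c"
  using smooth_structure unfolding smooth_structure_def by blast

lemma chart_around: "\<exists>c\<in>A. p \<in> fst c"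
  using smooth_structure unfolding smooth_structure_def by blast

lemma maximal: "is_chart c \<Longrightarrow> (\<And>d. d \<in> A \<Longrightarrow> smoothly_compatible c d) \<Longrightarrow> c \<in> A"
  using smooth_structure unfolding smooth_structure_def by blast

lemma smooth_transition:
  assumes "c \<in> A" "d \<in> A"
  shows "smooth_on (transition c d) (snd c ` (fst c \<inter> fst d))"
  using smooth_structure assms unfolding smooth_structure_def smoothly_compatible_def by blast

lemma open_overlap: "c \<in> A \<Longrightarrow> d \<in> A \<Longrightarrow> open (snd c ` (fst c \<inter> fst d))"
  by (intro chart_open_image[OF chart] open_Int is_chartD(1)[OF chart]) auto

lemma transition_has_derivative:
  assumes "c \<in> A" "d \<in> A" "p \<in> fst c" "p \<in> fst d"
  shows "(transition c d has_derivative (*v) (transition_jacobian c d p)) (at (snd c p))"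
proof -
  have "transition c d differentiable (at (snd c p))"
    using smooth_on_differentiable[OF smooth_transition[OF assms(1,2)]] assms(3,4) by blast
  then show ?thesis unfolding jacobian_works transition_jacobian_def .
qed

lemma transition_jacobian_apply:
  assumes "c \<in> A" "d \<in> A" "p \<in> fst c" "p \<in> fst d"
  shows "transition_jacobian c d p *v v = frechet_derivative (transition c d) (at (snd c p)) v"
  using frechet_derivative_at[OF transition_has_derivative[OF assms]] by metis

lemma transition_jacobian_cocycle:
  assumes c: "c \<in> A" "p \<in> fst c" and d: "d \<in> A" "p \<in> fst d" and e: "e \<in> A" "p \<in> fst e"
  shows "transition_jacobian d e p ** transition_jacobian c d p = transition_jacobian c e p"
proof -
  have p: "snd c p \<in> snd c ` (fst c \<inter> fst d)" using c d by blast
  have "((\<lambda>x. transition d e (transition c d x)) has_derivative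
      (\<lambda>v. transition_jacobian d e p *v (transition_jacobian c d p *v v))) (at (snd c p))"
    by (rule has_derivative_compose[OF transition_has_derivative[OF c(1) d(1) c(2) d(2)]])
      (use transition_has_derivative[OF d(1) e(1) d(2) e(2)] c in \<open>simp add: transition_chart[OF chart]\<close>)
  then have "(transition c e has_derivative
      (\<lambda>v. transition_jacobian d e p *v (transition_jacobian c d p *v v))) (at (snd c p))"
    by (rule has_derivative_transform_within_open[OF _ open_overlap[OF c(1) d(1)] p])
      (use c d in \<open>auto simp: transition_chart[OF chart]\<close>)
  from has_derivative_unique[OF this transition_has_derivative[OF c(1) e(1) c(2) e(2)]]
  show ?thesis by (simp add: matrix_eq matrix_vector_mul_assoc[symmetric] fun_eq_iff)
qed

lemma transition_jacobian_self:
  assumes "c \<in> A" "p \<in> fst c"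
  shows "transition_jacobian c c p = mat 1"
proof -
  have "((\<lambda>x. x) has_derivative (*v) (transition_jacobian c c p)) (at (snd c p))"
    by (rule has_derivative_transform_within_open[OF transition_has_derivative is_chartD(2)[OF chart]])
      (use assms in \<open>auto simp: transition_chart[OF chart]\<close>)
  from has_derivative_unique[OF this has_derivative_ident]
  show ?thesis by (simp add: matrix_eq fun_eq_iff)
qed

lemma smooth_vector_field_transition:
  assumes "smooth_vector_field A X" "c \<in> A" "d \<in> A" "p \<in> fst c" "p \<in> fst d"
  shows "X d p = transition_jacobian c d p *v X c p"
  using assms unfolding smooth_vector_field_def by blast

lemma smooth_vector_field_chart:
  assumes "smooth_vector_field A X" "c \<in> A"
  shows "smooth_on (\<lambda>x. X c (chart_inv c x)) (snd c ` fst c)"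
  using assms unfolding smooth_vector_field_def by blast

lemma smooth_tensor_apply:
  assumes T: "smooth_tensor_field A T" and X: "smooth_vector_field A X"
  shows "smooth_vector_field A (tensor_apply T X)"
  unfolding smooth_vector_field_def tensor_apply_def
proof (intro conjI ballI)
  fix c assume c: "c \<in> A"
  show "smooth_on (\<lambda>x. T c (chart_inv c x) *v X c (chart_inv c x)) (snd c ` fst c)"
    by (intro smooth_on_matrix_vector_mult[OF is_chartD(2)[OF chart[OF c]]]
        smooth_vector_field_chart[OF X c]) (use T c in \<open>unfold smooth_tensor_field_def, blast\<close>)
  fix d p assume d: "d \<in> A" and p: "p \<in> fst c \<inter> fst d"
  have "T d p *v X d p = (T d p ** transition_jacobian c d p) *v X c p"
    using smooth_vector_field_transition[OF X c d] p by (simp add: matrix_vector_mul_assoc)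
  also have "\<dots> = (transition_jacobian c d p ** T c p) *v X c p"
    using T c d p unfolding smooth_tensor_field_def by metis
  finally show "T d p *v X d p = transition_jacobian c d p *v (T c p *v X c p)"
    by (simp add: matrix_vector_mul_assoc)
qed

lemma lie_bracket_transition:
  assumes X: "smooth_vector_field A X" and Y: "smooth_vector_field A Y"
    and c: "c \<in> A" "p \<in> fst c" and d: "d \<in> A" "p \<in> fst d"
  shows "lie_bracket X Y d p = transition_jacobian c d p *v lie_bracket X Y c p"
proof -
  let ?O = "snd c ` (fst c \<inter> fst d)" and ?x = "snd c p" and ?\<tau> = "transition c d"
  have x: "?x \<in> ?O" using c d by blast
  have \<tau>x: "?\<tau> ?x = snd d p" by (rule transition_chart[OF chart[OF c(1)] c(2)])
  have inv: "chart_inv c ?x = p" "chart_inv d (snd d p) = p"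
    using c d by (simp_all add: chart_inv_left[OF chart])
  have diff: "(\<lambda>x. Z e (chart_inv e x)) differentiable (at (snd e p))"
    if "smooth_vector_field A Z" "e \<in> A" "p \<in> fst e" for Z e
    using smooth_on_differentiable[OF smooth_vector_field_chart[OF that(1,2)]] that(3) by blast
  have rel: "Z d (chart_inv d (?\<tau> y)) = frechet_derivative ?\<tau> (at y) (Z c (chart_inv c y))"
    if Z: "smooth_vector_field A Z" and y: "y \<in> ?O" for Z y
  proof -
    obtain q where q: "q \<in> fst c" "q \<in> fst d" "y = snd c q" using y by blast
    then show ?thesis
      using smooth_vector_field_transition[OF Z c(1) d(1)] transition_jacobian_apply[OF c(1) d(1)]
      by (simp add: transition_chart[OF chart[OF c(1)]] chart_inv_left[OF chart] c(1) d(1))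
  qed
  show ?thesis
    unfolding lie_bracket_def transition_jacobian_apply[OF c(1) d(1) c(2) d(2)]
    using bracket_pushforward[OF open_overlap[OF c(1) d(1)] smooth_transition[OF c(1) d(1)] x
        diff[OF X c] diff[OF Y c] _ _ rel[OF X] rel[OF Y]] diff[OF X d] diff[OF Y d]
    by (simp add: \<tau>x inv)
qed

end

section \<open>Bump functions and slice charts\<close>

lemma bump_function:
  fixes x0 :: "'a::euclidean_space"
  assumes "e > 0"
  shows "\<exists>\<beta>::'a \<Rightarrow> real. smooth_on \<beta> UNIV \<and> \<beta> x0 = 1 \<and> (\<beta> has_derivative (\<lambda>_. 0)) (at x0)
    \<and> (\<forall>y. y \<notin> ball x0 e \<longrightarrow> \<beta> y = 0)"
proof -
  define f :: "real \<Rightarrow> real" where "f s = (if s > 0 then exp (- inverse s) else 0)" for s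
  have f: "smooth_on f UNIV" unfolding f_def[abs_def] by (rule smooth_on_exp_neg_inverse)
  define q where "q y = 1 - inverse (e\<^sup>2) * ((y - x0) \<bullet> (y - x0))" for y
  have sub: "smooth_on (\<lambda>y. y - x0) UNIV"
    by (intro smooth_on_diff smooth_on_ident smooth_on_const open_UNIV)
  have q: "smooth_on q UNIV"
    unfolding q_def[abs_def]
    by (rule smooth_on_diff[OF open_UNIV smooth_on_const[OF open_UNIV] smooth_on_mult[OF open_UNIV
          smooth_on_const[OF open_UNIV] smooth_on_bilinear[OF bounded_bilinear_inner open_UNIV sub sub]]])
  \<comment> \<open>\<open>q x0 = 1\<close> and \<open>f 1 = exp (-1)\<close>, so
    \<open>exp 1\<close> normalises the value at the centre; the derivative vanishes there because
    that of the quadratic \<open>q\<close> does.\<close>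
  define \<beta> where "\<beta> y = exp 1 * f (q y)" for y
  have "smooth_on \<beta> UNIV"
    unfolding \<beta>_def[abs_def]
    by (rule smooth_on_mult[OF open_UNIV smooth_on_const[OF open_UNIV] smooth_on_compose[OF open_UNIV f q]]) auto
  moreover have "\<beta> x0 = 1" by (simp add: \<beta>_def q_def f_def exp_minus)
  moreover have "(\<beta> has_derivative (\<lambda>_. 0)) (at x0)"
  proof -
    have "(q has_derivative (\<lambda>_. 0)) (at x0)"
      unfolding q_def[abs_def] by (auto intro!: derivative_eq_intros)
    from has_derivative_compose[OF this smooth_on_has_derivative[OF f UNIV_I]]
    have "((\<lambda>y. f (q y)) has_derivative (\<lambda>_. 0)) (at x0)"
      using linear_0[OF has_derivative_linear[OF smooth_on_has_derivative[OF f UNIV_I]]] by simp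
    from has_derivative_mult_right[OF this, of "exp 1"] show ?thesis by (simp add: \<beta>_def[abs_def])
  qed
  moreover have "\<beta> y = 0" if "y \<notin> ball x0 e" for y
  proof -
    have "e\<^sup>2 \<le> (norm (y - x0))\<^sup>2"
      using that assms by (intro power_mono) (auto simp: dist_norm norm_minus_commute)
    then have "q y \<le> 0" using assms by (simp add: q_def power2_norm_eq_inner field_simps)
    then show ?thesis by (simp add: \<beta>_def f_def)
  qed
  ultimately show ?thesis by blast
qed

context smooth_manifold
begin

text \<open>Multiplying by a bump function with value 1 and derivative 0 at the point preserves the
  1-jet, which is all that a Lie bracket sees.\<close>

lemma extend_vector_field:
  assumes c: "c \<in> A" "p \<in> fst c" and W: "open W" "W \<subseteq> snd c ` fst c" "snd c p \<in> W"
    and a: "smooth_on a W"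
  shows "\<exists>X. smooth_vector_field A X \<and> X c p = a (snd c p) \<and>
    ((\<lambda>x. X c (chart_inv c x)) has_derivative frechet_derivative a (at (snd c p))) (at (snd c p))"
proof -
  let ?x = "snd c p"
  obtain e where e: "e > 0" "cball ?x e \<subseteq> W" using W(1,3) open_contains_cball by blast
  obtain \<beta> :: "real^'n \<Rightarrow> real" where \<beta>: "smooth_on \<beta> UNIV" "\<beta> ?x = 1"
    "(\<beta> has_derivative (\<lambda>_. 0)) (at ?x)" "\<And>y. y \<notin> ball ?x e \<Longrightarrow> \<beta> y = 0"
    using bump_function[OF e(1)] by blast
  define b where "b y = (if y \<in> W then \<beta> y *\<^sub>R a y else 0)" for y
  have b0: "b y = 0" if "y \<notin> cball ?x e" for y
    using \<beta>(4)[of y] that ball_subset_cball by (auto simp: b_def)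
  have "smooth_on b W"
  proof (rule smooth_on_cong[OF _ W(1)])
    show "smooth_on (\<lambda>y. \<beta> y *\<^sub>R a y) W"
      by (rule smooth_on_scaleR[OF W(1) smooth_on_subset[OF \<beta>(1) subset_UNIV] a])
  qed (simp add: b_def)
  moreover have "smooth_on b (- cball ?x e)"
    by (rule smooth_on_cong[OF smooth_on_const]) (simp_all add: b0 open_Compl)
  ultimately have "smooth_on b (W \<union> - cball ?x e)"
    by (intro smooth_on_Un W(1) open_Compl closed_cball)
  moreover have "W \<union> - cball ?x e = UNIV" using e(2) by blast
  ultimately have b: "smooth_on b UNIV" by simp
  define X where "X d q = (if q \<in> fst c then transition_jacobian c d q *v b (snd c q) else 0)" for d q
  define K where "K = chart_inv c ` cball ?x e"
  have "compact K"
    unfolding K_def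
    by (rule compact_continuous_image[OF continuous_on_subset[OF is_chartD(5)[OF chart[OF c(1)]]]
          compact_cball]) (use e(2) W(2) in blast)
  \<comment> \<open>Hausdorffness makes \<open>K\<close>, outside which the field vanishes, closed
    in the whole manifold. In any chart \<open>d\<close> the field is then smooth on the overlap
    with \<open>c\<close> and zero off \<open>K\<close>, and these two open sets cover the domain of
    \<open>d\<close>.\<close>
  then have K: "closed K" by (rule compact_imp_closed)
  have X0: "X d q = 0" if "q \<notin> K" for d q
  proof (cases "q \<in> fst c")
    case True
    then have "snd c q \<notin> cball ?x e"
      using that chart_inv_left[OF chart[OF c(1)] True] unfolding K_def by (metis imageI)
    then show ?thesis by (simp add: X_def b0)
  qed (simp add: X_def)
  have "smooth_vector_field A X"
    unfolding smooth_vector_field_def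
  proof (intro conjI ballI)
    fix d assume d: "d \<in> A"
    let ?O = "snd d ` (fst d \<inter> fst c)" and ?O' = "snd d ` (fst d - K)"
    have O: "open ?O" by (rule open_overlap[OF d c(1)])
    have O': "open ?O'"
      by (rule chart_open_image[OF chart[OF d]]) (use is_chartD(1)[OF chart[OF d]] K in auto)
    have "smooth_on (\<lambda>x. frechet_derivative (transition c d) (at (transition d c x)) (b (transition d c x))) ?O"
    proof (rule smooth_on_compose[OF O smooth_on_along_field smooth_transition[OF d c(1)]])
      show "transition d c ` ?O \<subseteq> snd c ` (fst c \<inter> fst d)"
        by (auto simp: transition_chart[OF chart[OF d]])
    qed (rule open_overlap[OF c(1) d] smooth_transition[OF c(1) d] smooth_on_subset[OF b subset_UNIV])+
    then have "smooth_on (\<lambda>x. X d (chart_inv d x)) ?O"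
    proof (rule smooth_on_cong[OF _ O])
      fix x assume "x \<in> ?O"
      then obtain q where q: "q \<in> fst d" "q \<in> fst c" "x = snd d q" by blast
      then show "frechet_derivative (transition c d) (at (transition d c x)) (b (transition d c x))
          = X d (chart_inv d x)"
        by (simp add: X_def transition_chart[OF chart[OF d]] chart_inv_left[OF chart[OF d]]
            transition_jacobian_apply[OF c(1) d])
    qed
    moreover have "smooth_on (\<lambda>x. X d (chart_inv d x)) ?O'"
      by (rule smooth_on_cong[OF smooth_on_const[OF O'] O'])
        (auto simp: chart_inv_left[OF chart[OF d]] X0)
    ultimately have "smooth_on (\<lambda>x. X d (chart_inv d x)) (?O \<union> ?O')"
      by (rule smooth_on_Un[OF _ _ O O'])
    moreover have "K \<subseteq> fst c" using e(2) W(2) chart_inv_right(2)[of _ c] by (auto simp: K_def)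
    then have "?O \<union> ?O' = snd d ` fst d" unfolding image_Un[symmetric] by (intro arg_cong[where f = "(`) (snd d)"]) blast
    ultimately show "smooth_on (\<lambda>x. X d (chart_inv d x)) (snd d ` fst d)" by simp
    fix d' q assume d': "d' \<in> A" and q: "q \<in> fst d \<inter> fst d'"
    show "X d' q = transition_jacobian d d' q *v X d q"
    proof (cases "q \<in> fst c")
      case True
      then show ?thesis
        using transition_jacobian_cocycle[OF c(1) True d _ d'] q
        by (simp add: X_def matrix_vector_mul_assoc)
    qed (simp add: X_def)
  qed
  moreover have Xc: "X c (chart_inv c y) = b y" if "y \<in> snd c ` fst c" for y
    using that chart_inv_right[OF that]
    by (simp add: X_def transition_jacobian_self[OF c(1)])
  moreover have "X c p = a ?x"
    using Xc[of ?x] c(2) W(3) chart_inv_left[OF chart[OF c(1)] c(2)] by (simp add: b_def \<beta>(2))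
  moreover have "((\<lambda>x. X c (chart_inv c x)) has_derivative frechet_derivative a (at ?x)) (at ?x)"
  proof (rule has_derivative_transform_within_open[OF _ W(1,3)])
    show "((\<lambda>y. \<beta> y *\<^sub>R a y) has_derivative frechet_derivative a (at ?x)) (at ?x)"
      using has_derivative_scaleR[OF \<beta>(3) smooth_on_has_derivative[OF a W(3)]] by (simp add: \<beta>(2))
    show "\<beta> y *\<^sub>R a y = X c (chart_inv c y)" if "y \<in> W" for y
      using Xc[of y] that W(2) by (auto simp: b_def)
  qed
  ultimately show ?thesis by blast
qed

section \<open>Slice charts, tangent spaces of submanifolds and images of tensor fields\<close>

lemma slice_chartD:
  assumes "slice_chart A S q b V"
  shows "b \<in> A" "q \<in> fst b" "subspace V" "r \<in> S \<Longrightarrow> r \<in> fst b \<Longrightarrow> snd b r \<in> V"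
    "r \<in> fst b \<Longrightarrow> snd b r \<in> V \<Longrightarrow> r \<in> S"
proof -
  have eq: "snd b ` (S \<inter> fst b) = snd b ` fst b \<inter> V"
    using assms by (simp add: slice_chart_def)
  show b: "b \<in> A" and "q \<in> fst b" "subspace V" using assms by (auto simp: slice_chart_def)
  show "snd b r \<in> V" if "r \<in> S" "r \<in> fst b" using that eq by blast
  show "r \<in> S" if r: "r \<in> fst b" "snd b r \<in> V"
  proof -
    have "snd b r \<in> snd b ` (S \<inter> fst b)" using eq r by blast
    then obtain r' where "r' \<in> S" "r' \<in> fst b" "snd b r = snd b r'" by blast
    then show ?thesis using is_chartD(3)[OF chart[OF b]] r(1) by (metis inj_onD)
  qed
qed

lemma eventually_on_line:
  fixes x :: "real^'m::finite"
  assumes "open O'" "x \<in> O'"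
  shows "\<forall>\<^sub>F t in at 0. x + t *\<^sub>R v \<in> O'"
proof -
  have "((\<lambda>t. x + t *\<^sub>R v) \<longlongrightarrow> x + 0 *\<^sub>R v) (at 0)" by (intro tendsto_intros)
  then show ?thesis using assms topological_tendstoD by fastforce
qed

text \<open>A line in \<open>V'\<close> through the point stays in \<open>S\<close> for short times,
  so its image in the other slice chart stays in \<open>V\<close>, and so does the velocity. Tangent
  spaces are therefore independent of the slice chart.\<close>

lemma slice_chart_transition:
  assumes b: "slice_chart A S q b V" and b': "slice_chart A S q b' V'" and q: "q \<in> S" and v: "v \<in> V'"
  shows "transition_jacobian b' b q *v v \<in> V"
proof (rule has_derivative_in_subspace[where f = "transition b' b" and x = "snd b' q"
      and f' = "(*v) (transition_jacobian b' b q)" and v = v])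
  note B = slice_chartD[OF b] and B' = slice_chartD[OF b']
  show "(transition b' b has_derivative (*v) (transition_jacobian b' b q)) (at (snd b' q))"
    by (rule transition_has_derivative[OF B'(1) B(1) B'(2) B(2)])
  show "subspace V" by (rule B(3))
  show "transition b' b (snd b' q) \<in> V"
    using B(4)[OF q B(2)] by (simp add: transition_chart[OF chart[OF B'(1)] B'(2)])
  have "snd b' q \<in> snd b' ` (fst b' \<inter> fst b)" using B(2) B'(2) by blast
  from eventually_on_line[OF open_overlap[OF B'(1) B(1)] this, of v]
  show "\<forall>\<^sub>F t in at 0. transition b' b (snd b' q + t *\<^sub>R v) \<in> V"
  proof (rule eventually_mono)
    fix t assume "snd b' q + t *\<^sub>R v \<in> snd b' ` (fst b' \<inter> fst b)"
    then obtain r where r: "r \<in> fst b'" "r \<in> fst b" "snd b' q + t *\<^sub>R v = snd b' r" by blast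
    have "snd b' q + t *\<^sub>R v \<in> V'"
      using B'(4)[OF q B'(2)] v B'(3) by (simp add: subspace_add subspace_scale)
    then have "r \<in> S" using B'(5)[OF r(1)] r(3) by simp
    then show "transition b' b (snd b' q + t *\<^sub>R v) \<in> V"
      using B(4)[OF _ r(2)] by (simp add: r(3) transition_chart[OF chart[OF B'(1)] r(1)])
  qed
qed

lemma submanifold_tangent_space_slice:
  assumes b: "slice_chart A S q b V" and q: "q \<in> S" and c: "c \<in> A" "q \<in> fst c"
  shows "submanifold_tangent_space A S c q = (*v) (transition_jacobian b c q) ` V"
proof (intro equalityI subsetI)
  fix w assume "w \<in> submanifold_tangent_space A S c q"
  then obtain b' V' v where b': "slice_chart A S q b' V'" and v: "v \<in> V'"
    and w: "w = transition_jacobian b' c q *v v"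
    unfolding submanifold_tangent_space_def by blast
  note B = slice_chartD[OF b] and B' = slice_chartD[OF b']
  have "w = transition_jacobian b c q *v (transition_jacobian b' b q *v v)"
    using transition_jacobian_cocycle[OF B'(1,2) B(1,2) c] w by (simp add: matrix_vector_mul_assoc)
  then show "w \<in> (*v) (transition_jacobian b c q) ` V"
    using slice_chart_transition[OF b b' q v] by blast
next
  fix w assume "w \<in> (*v) (transition_jacobian b c q) ` V"
  then show "w \<in> submanifold_tangent_space A S c q"
    using b unfolding submanifold_tangent_space_def by blast
qed

text \<open>The Jacobian intertwines the components of \<open>T\<close> and is invertible by the
  cocycle rule, so the images form a distribution independent of the chart.\<close>

lemma range_tensor_transition:
  assumes T: "smooth_tensor_field A T" and c: "c \<in> A" "p \<in> fst c" and d: "d \<in> A" "p \<in> fst d"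
  shows "(*v) (transition_jacobian c d p) ` range ((*v) (T c p)) = range ((*v) (T d p))"
proof -
  let ?J = "transition_jacobian c d p"
  have "T d p ** ?J = ?J ** T c p" using T c d unfolding smooth_tensor_field_def by blast
  then have comm: "T d p *v (?J *v u) = ?J *v (T c p *v u)" for u
    by (simp add: matrix_vector_mul_assoc)
  have surj: "?J *v (transition_jacobian d c p *v u) = u" for u
    using transition_jacobian_cocycle[OF d c d] transition_jacobian_self[OF d]
    by (simp add: matrix_vector_mul_assoc)
  show ?thesis
  proof (intro equalityI subsetI)
    fix w assume "w \<in> (*v) ?J ` range ((*v) (T c p))"
    then show "w \<in> range ((*v) (T d p))" by (auto simp: comm[symmetric])
  next
    fix w assume "w \<in> range ((*v) (T d p))"
    then obtain u where "w = T d p *v u" by blast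
    then have "w = ?J *v (T c p *v (transition_jacobian d c p *v u))" by (simp add: comm[symmetric] surj)
    then show "w \<in> (*v) ?J ` range ((*v) (T c p))" by blast
  qed
qed

end

section \<open>F-structures\<close>

lemma matpow_Suc: "matpow B (Suc k) = B ** matpow B k"
  by (simp add: matpow_def)

lemma matpow_Suc2: "matpow B (Suc k) = matpow B k ** B"
  by (induction k) (simp_all add: matpow_def matrix_mul_assoc)

lemma mat_matrix_vector_mult: "(mat a ** M) *v x = a *s (M *v x)"
  for M :: "'k::comm_semiring_1^'n^'n::finite"
proof -
  have "mat a *v y = a *s y" for y :: "'k^'n"
    by (simp add: vec_eq_iff matrix_vector_mult_def mat_def if_distrib[of "\<lambda>z. z * _"] cong: if_cong)
  then show ?thesis by (simp add: matrix_vector_mul_assoc[symmetric])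
qed

text \<open>Two factorisations: the polynomial identity says \<open>l ** B = B\<close>, and
  \<open>l\<close> is \<open>B\<close> times a polynomial in \<open>B\<close> because both exponents
  \<open>K\<close> and \<open>K - 1\<close> are positive.\<close>

lemma
  fixes B :: "complex^'n::finite^'n" and \<alpha> \<beta> :: complex and K :: nat
  defines "l \<equiv> - (mat \<alpha> ** matpow B K + mat \<beta> ** matpow B (K - 1))"
  assumes eq: "mat \<alpha> ** matpow B (K + 1) + mat \<beta> ** matpow B K + B = 0" and "K \<ge> 2"
  shows l_fixed_iff: "l *v w = w \<longleftrightarrow> w \<in> range ((*v) B)" and range_l: "range ((*v) l) = range ((*v) B)"
proof -
  have l: "l *v w = - (\<alpha> *s (matpow B K *v w) + \<beta> *s (matpow B (K - 1) *v w))" for w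
    unfolding l_def
    using matrix_vector_mult_diff_rdistrib[of 0 "mat \<alpha> ** matpow B K + mat \<beta> ** matpow B (K - 1)" w]
    by (simp add: matrix_vector_mult_add_rdistrib mat_matrix_vector_mult)
  \<comment> \<open>This makes \<open>K - 1\<close> a successor, so that a factor \<open>B\<close>
    splits off from both powers.\<close>
  obtain j where K: "K = Suc (Suc j)" using \<open>K \<ge> 2\<close> by (cases K; cases "K - 1") auto
  have fixed: "l *v (B *v u) = B *v u" for u
  proof -
    have "\<alpha> *s (matpow B (K + 1) *v u) + \<beta> *s (matpow B K *v u) + B *v u = 0"
      using arg_cong[OF eq, of "\<lambda>M. M *v u"]
      by (simp only: matrix_vector_mult_add_rdistrib mat_matrix_vector_mult matrix_vector_mult_0)
    moreover have "matpow B K *v (B *v u) = matpow B (K + 1) *v u"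
      "matpow B (K - 1) *v (B *v u) = matpow B K *v u"
      by (simp_all add: K matpow_Suc2[of B "Suc j"] matpow_Suc2[of B "Suc (Suc j)"]
          matrix_vector_mul_assoc)
    ultimately show ?thesis unfolding l by (simp add: add_eq_0_iff2)
  qed
  have in_range: "l *v w \<in> range ((*v) B)" for w
  proof -
    have "matpow B K *v w = B *v (matpow B (Suc j) *v w)" "matpow B (K - 1) *v w = B *v (matpow B j *v w)"
      by (simp_all add: K matpow_Suc matrix_vector_mul_assoc)
    then have "l *v w = B *v (- (\<alpha> *s (matpow B (Suc j) *v w) + \<beta> *s (matpow B j *v w)))"
      unfolding l by (simp only: vec.neg vec.add vec.scale)
    then show ?thesis by blast
  qed
  show "l *v w = w \<longleftrightarrow> w \<in> range ((*v) B)" using fixed in_range[of w] by (auto simp del: rangeI)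
  have "B *v u \<in> range ((*v) l)" for u using fixed[of u] by (metis rangeI)
  then show "range ((*v) l) = range ((*v) B)" using in_range by blast
qed

text \<open>A real matrix acts on real and imaginary parts separately.\<close>

lemma range_complexify:
  fixes M :: "real^'n::finite^'n"
  shows "range ((*v) (map_matrix complex_of_real M)) = complexify_subspace (range ((*v) M))"
proof (intro equalityI subsetI)
  fix w assume "w \<in> range ((*v) (map_matrix complex_of_real M))"
  then obtain z where w: "w = map_matrix complex_of_real M *v z" by blast
  have "(\<chi> i. Re (w $ i)) = M *v (\<chi> i. Re (z $ i))" "(\<chi> i. Im (w $ i)) = M *v (\<chi> i. Im (z $ i))"
    by (simp_all add: w vec_eq_iff matrix_vector_mult_def)
  then show "w \<in> complexify_subspace (range ((*v) M))" by (simp add: complexify_subspace_def)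
next
  fix w assume "w \<in> complexify_subspace (range ((*v) M))"
  then obtain u v where "(\<chi> i. Re (w $ i)) = M *v u" "(\<chi> i. Im (w $ i)) = M *v v"
    by (auto simp: complexify_subspace_def)
  then have "w = map_matrix complex_of_real M *v (\<chi> i. Complex (u $ i) (v $ i))"
    by (simp add: vec_eq_iff matrix_vector_mult_def complex_eq_iff)
  then show "w \<in> range ((*v) (map_matrix complex_of_real M))" by blast
qed

text \<open>The imaginary part of a real vector is 0, whence the assumption
  \<open>0 \<in> V\<close>.\<close>

lemma complex_of_real_in_complexify_subspace:
  "0 \<in> V \<Longrightarrow> (\<chi> i. complex_of_real (u $ i)) \<in> complexify_subspace V \<longleftrightarrow> u \<in> V"
  by (simp add: complexify_subspace_def flip: zero_vec_def)

lemma complexify_subspace_inject: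
  assumes "0 \<in> V" "0 \<in> W" "complexify_subspace V = complexify_subspace W"
  shows "V = W"
  using assms complex_of_real_in_complexify_subspace by (metis subsetI subset_antisym)

locale F_structure =
  fixes A :: "('a::{t2_space, second_countable_topology}, 'n::finite) chart set"
    and F :: "('a, 'n, real) tfield" and K r :: nat and \<alpha> \<beta> :: complex
  assumes F_structure: "F_structure_manifold A K \<alpha> \<beta> r F"

sublocale F_structure \<subseteq> smooth_manifold A
  using F_structure by unfold_locales (simp add: F_structure_manifold_def)

context F_structure
begin

lemma smooth_F: "smooth_tensor_field A F"
  using F_structure unfolding F_structure_manifold_def by blast

lemma smooth_FX: "smooth_vector_field A X \<Longrightarrow> smooth_vector_field A (tensor_apply F X)"
  by (rule smooth_tensor_apply[OF smooth_F])

lemma rank_F: "c \<in> A \<Longrightarrow> p \<in> fst c \<Longrightarrow> rank (F c p) = r"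
  using F_structure unfolding F_structure_manifold_def by blast

lemma polynomial_F:
  assumes "c \<in> A" "p \<in> fst c"
  shows "mat \<alpha> ** matpow (complexify_tfield F c p) (K + 1)
    + mat \<beta> ** matpow (complexify_tfield F c p) K + complexify_tfield F c p = 0"
  using F_structure assms unfolding F_structure_manifold_def Let_def by blast

lemma K_ge: "K \<ge> 2"
  using F_structure unfolding F_structure_manifold_def by linarith

text \<open>The complex coefficients disappear here: \<open>D_l\<close> becomes the complexification
  of a real distribution and can be compared with real tangent spaces.\<close>

lemma D_l_eq:
  assumes "c \<in> A" "p \<in> fst c"
  shows "D_l K \<alpha> \<beta> F c p = complexify_subspace (range ((*v) (F c p)))"
  using range_l[OF polynomial_F[OF assms] K_ge] range_complexify[of "F c p"]
  by (simp add: D_l_def l_tensor_def Let_def complexify_tfield_def)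

lemma vfield_eq_l_iff:
  "vfield_eq A (complexify_vfield Z) (tensor_apply (l_tensor K \<alpha> \<beta> F) (complexify_vfield Z)) \<longleftrightarrow>
    (\<forall>c\<in>A. \<forall>p\<in>fst c. Z c p \<in> range ((*v) (F c p)))"
proof -
  have "complexify_vfield Z c p = l_tensor K \<alpha> \<beta> F c p *v complexify_vfield Z c p \<longleftrightarrow> Z c p \<in> range ((*v) (F c p))"
    if "c \<in> A" "p \<in> fst c" for c p
  proof -
    have "0 \<in> range ((*v) (F c p))" by (metis matrix_vector_mult_0_right rangeI)
    then have "complexify_vfield Z c p \<in> range ((*v) (complexify_tfield F c p)) \<longleftrightarrow> Z c p \<in> range ((*v) (F c p))"
      unfolding complexify_tfield_def range_complexify complexify_vfield_def
      by (rule complex_of_real_in_complexify_subspace)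
    then show ?thesis
      using l_fixed_iff[OF polynomial_F[OF that] K_ge, of "complexify_vfield Z c p"]
      unfolding l_tensor_def Let_def by metis
  qed
  then show ?thesis by (simp add: vfield_eq_def tensor_apply_def)
qed

lemma nijenhuis_in_range_iff:
  "nijenhuis F X Y c p \<in> range ((*v) (F c p)) \<longleftrightarrow>
    lie_bracket (tensor_apply F X) (tensor_apply F Y) c p \<in> range ((*v) (F c p))"
proof -
  have V: "subspace (range ((*v) (F c p)))"
    by (rule linear_subspace_image[OF matrix_vector_mul_linear subspace_UNIV])
  have T: "tensor_apply F Z c p = F c p *v Z c p" for Z by (simp add: tensor_apply_def)
  obtain u where u: "nijenhuis F X Y c p
      = lie_bracket (tensor_apply F X) (tensor_apply F Y) c p + F c p *v u"
  proof
    show "nijenhuis F X Y c p = lie_bracket (tensor_apply F X) (tensor_apply F Y) c p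
        + F c p *v (F c p *v lie_bracket X Y c p - lie_bracket (tensor_apply F X) Y c p
          - lie_bracket X (tensor_apply F Y) c p)"
      by (simp add: nijenhuis_def T matrix_vector_mult_diff_distrib)
  qed
  show ?thesis unfolding u using V subspace_add[OF V] subspace_diff[OF V]
    by (metis add_diff_cancel_right' rangeI)
qed

text \<open>In a slice chart both halves of the bracket at \<open>p\<close> differentiate
  \<open>F X\<close> or \<open>F Y\<close> in a direction of \<open>V\<close>, hence along a line
  inside the slice, where these fields take values in \<open>V\<close>. Off the slice the image of
  \<open>F\<close> may differ from \<open>V\<close>, but those points do not enter.\<close>

lemma bracket_in_range:
  assumes int: "integrable_distribution A (D_l K \<alpha> \<beta> F)"
    and X: "smooth_vector_field A X" and Y: "smooth_vector_field A Y" and c: "c \<in> A" "p \<in> fst c"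
  shows "lie_bracket (tensor_apply F X) (tensor_apply F Y) c p \<in> range ((*v) (F c p))"
proof -
  obtain S where p: "p \<in> S" and S: "integral_manifold A (D_l K \<alpha> \<beta> F) S"
    using int unfolding integrable_distribution_def by blast
  then obtain b V where b: "slice_chart A S p b V"
    unfolding integral_manifold_def embedded_submanifold_def by blast
  note B = slice_chartD[OF b]
  \<comment> \<open>The equation of complexified tangent spaces holds at every point of
    \<open>S\<close> near \<open>p\<close>, and in the slice chart itself the tangent space is the
    constant \<open>V\<close>.\<close>
  have range: "range ((*v) (F b q)) = V" if q: "q \<in> S" "q \<in> fst b" for q
  proof -
    have bq: "slice_chart A S q b V" using b q by (simp add: slice_chart_def)
    have "complexify_subspace (submanifold_tangent_space A S b q) = complexify_subspace (range ((*v) (F b q)))"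
      using S q B(1) D_l_eq[OF B(1) q(2)] unfolding integral_manifold_def by metis
    then have "complexify_subspace V = complexify_subspace (range ((*v) (F b q)))"
      by (simp add: submanifold_tangent_space_slice[OF bq q(1) B(1) q(2)]
          transition_jacobian_self[OF B(1) q(2)])
    moreover have "0 \<in> range ((*v) (F b q))" by (metis matrix_vector_mult_0_right rangeI)
    ultimately show ?thesis using complexify_subspace_inject subspace_0[OF B(3)] by metis
  qed
  have FV: "tensor_apply F Z b q \<in> V" if "q \<in> S" "q \<in> fst b" for Z q
    using range[OF that] by (auto simp: tensor_apply_def)
  have tangent: "frechet_derivative (\<lambda>x. tensor_apply F Z b (chart_inv b x)) (at (snd b p)) v \<in> V"
    if Z: "smooth_vector_field A Z" and v: "v \<in> V" for Z v
  proof (rule has_derivative_in_subspace[where f = "\<lambda>x. tensor_apply F Z b (chart_inv b x)" and x = "snd b p" and v = v])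
    have x: "snd b p \<in> snd b ` fst b" using B(2) by blast
    show "((\<lambda>x. tensor_apply F Z b (chart_inv b x)) has_derivative
        frechet_derivative (\<lambda>x. tensor_apply F Z b (chart_inv b x)) (at (snd b p))) (at (snd b p))"
      by (rule smooth_on_has_derivative[OF smooth_vector_field_chart[OF smooth_FX[OF Z] B(1)] x])
    show "tensor_apply F Z b (chart_inv b (snd b p)) \<in> V"
      using FV[OF p B(2)] by (simp add: chart_inv_left[OF chart[OF B(1)] B(2)])
    show "\<forall>\<^sub>F t in at 0. tensor_apply F Z b (chart_inv b (snd b p + t *\<^sub>R v)) \<in> V"
    proof (rule eventually_mono[OF eventually_on_line[OF is_chartD(2)[OF chart[OF B(1)]] x]])
      fix t assume "snd b p + t *\<^sub>R v \<in> snd b ` fst b"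
      then obtain q where q: "q \<in> fst b" "snd b p + t *\<^sub>R v = snd b q" by blast
      have "snd b p + t *\<^sub>R v \<in> V"
        using B(4)[OF p B(2)] v B(3) by (simp add: subspace_add subspace_scale)
      then have "q \<in> S" using B(5) q by simp
      then show "tensor_apply F Z b (chart_inv b (snd b p + t *\<^sub>R v)) \<in> V"
        using FV[OF _ q(1)] by (simp add: q(2) chart_inv_left[OF chart[OF B(1)] q(1)])
    qed
  qed (rule B(3))
  have "lie_bracket (tensor_apply F X) (tensor_apply F Y) b p \<in> V"
    unfolding lie_bracket_def
    by (intro subspace_diff B(3) tangent X Y FV p B(2))
  then have "lie_bracket (tensor_apply F X) (tensor_apply F Y) c p
      \<in> (*v) (transition_jacobian b c p) ` range ((*v) (F b p))"
    using lie_bracket_transition[OF smooth_FX[OF X] smooth_FX[OF Y] B(1,2) c] range[OF p B(2)] by blast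
  then show ?thesis by (simp only: range_tensor_transition[OF smooth_F B(1,2) c])
qed

text \<open>In one chart around the point, \<open>F\<close> becomes a matrix function of constant
  rank; the leaf is the slice \<open>V\<close> of that chart after straightening.\<close>

lemma integrable_if_bracket_in_range:
  assumes br: "\<And>X Y c p. smooth_vector_field A X \<Longrightarrow> smooth_vector_field A Y \<Longrightarrow> c \<in> A \<Longrightarrow> p \<in> fst c \<Longrightarrow>
    lie_bracket (tensor_apply F X) (tensor_apply F Y) c p \<in> range ((*v) (F c p))"
  shows "integrable_distribution A (D_l K \<alpha> \<beta> F)"
  unfolding integrable_distribution_def
proof
  fix p
  obtain c where c: "c \<in> A" "p \<in> fst c" using chart_around by blast
  note ch = chart[OF c(1)]
  let ?U = "snd c ` fst c"
  define M where "M x = F c (chart_inv c x)" for x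
  have U: "open ?U" by (rule is_chartD(2)[OF ch])
  have smM: "smooth_on M ?U"
    unfolding M_def[abs_def] using smooth_F c(1) unfolding smooth_tensor_field_def by blast
  have rkM: "rank (M x) = r" if "x \<in> ?U" for x
    unfolding M_def by (rule rank_F[OF c(1) chart_inv_right(2)[OF that]])
  \<comment> \<open>Local coefficient fields \<open>a\<close> and \<open>b\<close> are replaced by
    global fields with the same 1-jet at the point, to which \<open>br\<close> applies.\<close>
  have involutive: "frechet_derivative (\<lambda>x. M x *v b x) (at x) (M x *v a x)
      - frechet_derivative (\<lambda>x. M x *v a x) (at x) (M x *v b x) \<in> range ((*v) (M x))"
    if W: "open W" "W \<subseteq> ?U" "x \<in> W" and a: "smooth_on a W" and b: "smooth_on b W" for W a b x
  proof -
    obtain q where q: "q \<in> fst c" "x = snd c q" using W by blast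
    have inv: "chart_inv c x = q" unfolding q(2) by (rule chart_inv_left[OF ch q(1)])
    have ext: "\<exists>X. smooth_vector_field A X \<and> X c q = a x \<and>
        frechet_derivative (\<lambda>x. tensor_apply F X c (chart_inv c x)) (at x)
        = frechet_derivative (\<lambda>x. M x *v a x) (at x)" if a: "smooth_on a W" for a
    proof -
      obtain X where X: "smooth_vector_field A X" "X c q = a x"
        "((\<lambda>x. X c (chart_inv c x)) has_derivative frechet_derivative a (at x)) (at x)"
        using extend_vector_field[OF c(1) q(1) W(1,2) _ a] W(3) unfolding q(2) by blast
      have M: "(M has_derivative frechet_derivative M (at x)) (at x)"
        using smooth_on_has_derivative[OF smM] W by blast
      \<comment> \<open>By the product rule the derivative of \<open>M x *v a x\<close> at the point
        depends only on value and derivative of \<open>a\<close> there, so the extended field gives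
        the same one.\<close>
      note deriv = bounded_bilinear.FDERIV[OF bounded_bilinear_matrix_vector_mult M]
      have 1: "((\<lambda>x. tensor_apply F X c (chart_inv c x)) has_derivative
          (\<lambda>h. M x *v frechet_derivative a (at x) h + frechet_derivative M (at x) h *v a x)) (at x)"
        using deriv[OF X(3)] by (simp add: tensor_apply_def M_def inv X(2))
      have 2: "((\<lambda>x. M x *v a x) has_derivative
          (\<lambda>h. M x *v frechet_derivative a (at x) h + frechet_derivative M (at x) h *v a x)) (at x)"
        by (rule deriv[OF smooth_on_has_derivative[OF a W(3)]])
      from X(1,2) frechet_derivative_at[OF 1] frechet_derivative_at[OF 2] show ?thesis by auto
    qed
    obtain X where X: "smooth_vector_field A X" "X c q = a x"
      "frechet_derivative (\<lambda>x. tensor_apply F X c (chart_inv c x)) (at x)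
        = frechet_derivative (\<lambda>x. M x *v a x) (at x)" using ext[OF a] by blast
    obtain Y where Y: "smooth_vector_field A Y" "Y c q = b x"
      "frechet_derivative (\<lambda>x. tensor_apply F Y c (chart_inv c x)) (at x)
        = frechet_derivative (\<lambda>x. M x *v b x) (at x)" using ext[OF b] by blast
    have M: "M x = F c q" by (simp add: M_def inv)
    have FX: "tensor_apply F X c q = M x *v a x" "tensor_apply F Y c q = M x *v b x"
      by (simp_all add: tensor_apply_def M X(2) Y(2))
    show ?thesis
      using br[OF X(1) Y(1) c(1) q(1)]
      unfolding lie_bracket_def q(2)[symmetric] X(3) Y(3) FX M[symmetric] .
  qed
  have x: "snd c p \<in> ?U" using c by blast
  show "\<exists>S. p \<in> S \<and> integral_manifold A (D_l K \<alpha> \<beta> F) S"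
  proof (rule straighten_leaf[OF U x smM rkM involutive])
    fix \<Phi> \<Psi> :: "real^'n \<Rightarrow> real^'n" and V N
    assume V: "subspace V" and N: "open N" "snd c p \<in> N" "N \<subseteq> ?U" and \<Psi>N: "open (\<Psi> ` N)"
      and sm\<Psi>: "smooth_on \<Psi> N" and sm\<Phi>: "smooth_on \<Phi> (\<Psi> ` N)"
      and \<Phi>\<Psi>: "\<And>x. x \<in> N \<Longrightarrow> \<Phi> (\<Psi> x) = x" and \<Psi>0: "\<Psi> (snd c p) \<in> V"
      and range: "\<And>x. x \<in> N \<Longrightarrow> \<Psi> x \<in> V \<Longrightarrow> range ((*v) (M x)) = frechet_derivative \<Phi> (at (\<Psi> x)) ` V"
    define b where "b = (fst c \<inter> snd c -` N, \<Psi> \<circ> snd c)"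
    have fst_b: "fst b = fst c \<inter> snd c -` N" and snd_b: "snd b q = \<Psi> (snd c q)" for q
      by (simp_all add: b_def)
    have img: "snd b ` fst b = \<Psi> ` N"
    proof -
      have "snd c ` (fst c \<inter> snd c -` N) = N" using N(3) by auto
      then show ?thesis unfolding b_def fst_conv snd_conv image_comp[symmetric] by simp
    qed
    have N_b: "snd c q \<in> N" "q \<in> fst c" if "q \<in> fst b" for q using that by (auto simp: fst_b)
    have b_chart: "is_chart b"
      unfolding is_chart_def
    proof (intro conjI exI)
      show "open (fst b)" unfolding fst_b by (rule chart_open_preimage[OF ch N(1)])
      show "open (snd b ` fst b)" using \<Psi>N by (simp add: img)
      show "homeomorphism (fst b) (snd b ` fst b) (snd b) (\<lambda>y. chart_inv c (\<Phi> y))"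
      proof (rule homeomorphismI)
        have "continuous_on (fst b) (\<lambda>q. \<Psi> (snd c q))"
          by (rule continuous_on_compose2[OF smooth_on_continuous_on[OF sm\<Psi>]
                continuous_on_subset[OF is_chartD(4)[OF ch]]]) (auto simp: fst_b)
        then show "continuous_on (fst b) (snd b)" by (simp add: b_def o_def)
        show "continuous_on (snd b ` fst b) (\<lambda>y. chart_inv c (\<Phi> y))"
          unfolding img using N(3)
          by (intro continuous_on_compose2[OF is_chartD(5)[OF ch] smooth_on_continuous_on[OF sm\<Phi>]])
            (auto simp: \<Phi>\<Psi>)
        show inv: "chart_inv c (\<Phi> (snd b q)) = q" if "q \<in> fst b" for q
          using N_b[OF that] by (simp add: snd_b \<Phi>\<Psi> chart_inv_left[OF ch])
        then show "(\<lambda>y. chart_inv c (\<Phi> y)) ` snd b ` fst b \<subseteq> fst b" by auto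
        show "snd b (chart_inv c (\<Phi> y)) = y" if "y \<in> snd b ` fst b" for y
          using that inv by auto
      qed auto
    qed
    have \<Phi>b: "\<Phi> (snd b q) = snd c q" if "q \<in> fst b" for q
      using \<Phi>\<Psi> N_b(1)[OF that] by (simp add: snd_b)
    \<comment> \<open>The transitions of \<open>b\<close> are those of \<open>c\<close> composed
      with \<open>\<Phi>\<close> or \<open>\<Psi>\<close>, hence smooth; maximality puts
      \<open>b\<close> into the atlas, as slice charts require.\<close>
    have b: "b \<in> A"
    proof (rule maximal[OF b_chart])
      fix d assume d: "d \<in> A"
      let ?O = "snd b ` (fst b \<inter> fst d)" and ?O' = "snd d ` (fst b \<inter> fst d)"
      have bd: "open (fst b \<inter> fst d)"
        by (intro open_Int is_chartD(1)[OF b_chart] is_chartD(1)[OF chart[OF d]])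
      have O: "open ?O" by (rule chart_open_image[OF b_chart bd]) auto
      have O': "open ?O'" by (rule chart_open_image[OF chart[OF d] bd]) auto
      have "smooth_on (\<lambda>y. transition c d (\<Phi> y)) ?O"
      proof (rule smooth_on_compose[OF O smooth_transition[OF c(1) d] smooth_on_subset[OF sm\<Phi>]])
        show "?O \<subseteq> \<Psi> ` N" using img by blast
        show "\<Phi> ` ?O \<subseteq> snd c ` (fst c \<inter> fst d)" using \<Phi>b N_b(2) by auto
      qed
      then have "smooth_on (transition b d) ?O"
      proof (rule smooth_on_cong[OF _ O])
        fix y assume "y \<in> ?O"
        then obtain q where q: "q \<in> fst b" "q \<in> fst d" "y = snd b q" by blast
        then show "transition c d (\<Phi> y) = transition b d y"
          by (simp add: \<Phi>b transition_chart[OF ch N_b(2)] transition_chart[OF b_chart])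
      qed
      moreover have "smooth_on (\<lambda>y. \<Psi> (transition d c y)) ?O'"
      proof (rule smooth_on_compose[OF O' sm\<Psi> smooth_on_subset[OF smooth_transition[OF d c(1)]]])
        show "?O' \<subseteq> snd d ` (fst d \<inter> fst c)" using N_b(2) by blast
        show "transition d c ` ?O' \<subseteq> N" using N_b(1) by (auto simp: transition_chart[OF chart[OF d]])
      qed
      then have "smooth_on (transition d b) ?O'"
        by (rule smooth_on_cong[OF _ O']) (auto simp: transition_chart[OF chart[OF d]] snd_b)
      ultimately show "smoothly_compatible b d" by (simp add: smoothly_compatible_def)
    qed
    \<comment> \<open>The leaf is the whole slice, so \<open>b\<close> is a slice chart at every
      point of it.\<close>
    define S where "S = {q \<in> fst b. snd b q \<in> V}"
    have slice: "slice_chart A S q b V" if "q \<in> S" for q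
      using that b V by (auto simp: slice_chart_def S_def)
    have "p \<in> S" using c N(2) \<Psi>0 by (simp add: S_def fst_b snd_b)
    moreover have "integral_manifold A (D_l K \<alpha> \<beta> F) S"
      unfolding integral_manifold_def
    proof (intro conjI exI ballI impI)
      show "embedded_submanifold A (dim V) S"
        unfolding embedded_submanifold_def using slice by blast
      fix q d assume q: "q \<in> S" and d: "d \<in> A" "q \<in> fst d"
      have qb: "q \<in> fst b" "\<Psi> (snd c q) \<in> V" using q by (auto simp: S_def snd_b)
      note qc = N_b[OF qb(1)]
      \<comment> \<open>\<open>\<Phi>\<close> is the transition from \<open>b\<close> to
        \<open>c\<close>, so \<open>range\<close> identifies the tangent space of the slice with
        \<open>Im F\<close> at all points of \<open>S\<close>, not only at \<open>p\<close>.\<close>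
      have "frechet_derivative \<Phi> (at (snd b q)) = frechet_derivative (transition b c) (at (snd b q))"
      proof (rule frechet_derivative_transform_within_open[OF _ is_chartD(2)[OF b_chart]])
        show "\<Phi> differentiable (at (snd b q))"
          by (rule smooth_on_differentiable[OF sm\<Phi>]) (use img qb(1) in blast)
      qed (use qb(1) \<Phi>b in \<open>auto simp: transition_chart[OF b_chart]\<close>)
      then have "range ((*v) (F c q)) = (*v) (transition_jacobian b c q) ` V"
        using range[OF qc(1) qb(2)] transition_jacobian_apply[OF b c(1) qb(1) qc(2)]
        by (simp add: M_def chart_inv_left[OF ch qc(2)] snd_b)
      then have "range ((*v) (F d q))
          = (*v) (transition_jacobian c d q) ` (*v) (transition_jacobian b c q) ` V"
        using range_tensor_transition[OF smooth_F c(1) qc(2) d] by simp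
      also have "\<dots> = (*v) (transition_jacobian b d q) ` V"
        using transition_jacobian_cocycle[OF b qb(1) c(1) qc(2) d]
        by (simp add: image_image matrix_vector_mul_assoc)
      also have "\<dots> = submanifold_tangent_space A S d q"
        by (rule submanifold_tangent_space_slice[OF slice[OF q] q d, symmetric])
      finally show "complexify_subspace (submanifold_tangent_space A S d q) = D_l K \<alpha> \<beta> F d q"
        by (simp add: D_l_eq[OF d])
    qed
    ultimately show "\<exists>S. p \<in> S \<and> integral_manifold A (D_l K \<alpha> \<beta> F) S" by blast
  qed
qed

end

theorem theorem5p4:
  fixes A :: "('a::{t2_space, second_countable_topology}, 'n::finite) chart set"
    and F :: "('a, 'n, real) tfield"
    and K r :: nat
    and \<alpha> \<beta> :: complex
  assumes "F_structure_manifold A K \<alpha> \<beta> r F"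
  shows "(integrable_distribution A (D_l K \<alpha> \<beta> F) \<longleftrightarrow>
           (\<forall>X Y. smooth_vector_field A X \<and> smooth_vector_field A Y \<longrightarrow>
              vfield_eq A (complexify_vfield (nijenhuis F X Y))
                (tensor_apply (l_tensor K \<alpha> \<beta> F) (complexify_vfield (nijenhuis F X Y))))) \<and>
         (integrable_distribution A (D_l K \<alpha> \<beta> F) \<longleftrightarrow>
           (\<forall>X Y. smooth_vector_field A X \<and> smooth_vector_field A Y \<longrightarrow>
              vfield_eq A (complexify_vfield (lie_bracket (tensor_apply F X) (tensor_apply F Y)))
                (tensor_apply (l_tensor K \<alpha> \<beta> F)
                  (complexify_vfield (lie_bracket (tensor_apply F X) (tensor_apply F Y))))))"
proof -
  interpret F_structure A F K r \<alpha> \<beta> by unfold_locales (rule assms)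
  \<comment> \<open>Both tensor conditions reduce pointwise to this membership, so one equivalence
    yields both claims.\<close>
  have "integrable_distribution A (D_l K \<alpha> \<beta> F) \<longleftrightarrow>
    (\<forall>X Y. smooth_vector_field A X \<and> smooth_vector_field A Y \<longrightarrow>
      (\<forall>c\<in>A. \<forall>p\<in>fst c. lie_bracket (tensor_apply F X) (tensor_apply F Y) c p \<in> range ((*v) (F c p))))"
    using bracket_in_range integrable_if_bracket_in_range by blast
  then show ?thesis unfolding vfield_eq_l_iff nijenhuis_in_range_iff by blast
qed

end
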